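(* Let $X\subset\mathbb{R}^n$ be compact and convex, let $Y=\{y_1,\dots,y_N\}\subset\mathbb{R}^n$ be a set of $N$ points, let $\rho$ be a probability measure on $X$, absolutely continuous with respect to Lebesgue measure, whose density satisfies $0<\underline{m}\le\rho(x)\le\overline{m}<\infty$ on $X$ for some constants $\underline{m},\overline{m}$, and let $\mu=\sum_{k=1}^N\mu_k\delta_{y_k}$ be a probability measure with $\mu_k\ge\underline{\mu}>0$ for all $k$. Let $c:X\times Y\to\mathbb{R}$ be of class $C^1$ in $x$ and such that for every $x_0\in X$ the map $Y\ni y\mapsto\nabla_x c(x_0,y)$ is injective. Let $\psi^0\in\mathbb{R}^N$ be such that $\mu_i=\rho(\mathrm{Lag}_i(\psi^0))$ for all $i$. Then there exist a constant $\widehat C>0$, independent of $t$, and a $\delta>0$ such that for all $t\in[0,1)$ and all $\widehat\psi\in\mathbb{R}^N$ with $\|\widehat\psi-\psi^0\|_2^2\le\delta$ and $\sum_i\widehat\psi_i=0$, $$\lambda_{\min}\{\nabla^{2,\perp}_{\psi,\psi}\Phi(\widehat\psi,t)\}\ge\widehat C>0.$$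
   Context: For $\psi\in\mathbb{R}^N$, the Laguerre cell of $y_i$ is $\mathrm{Lag}_i(\psi)=\{x\in X:\ c(x,y_i)-\psi_i\le c(x,y_k)-\psi_k\ \ \forall k\ne i\}$. For $t\in[0,1)$, $$\Phi(\psi,t)=\int_X(1-t)\log\Big[\sum_{k=1}^N e^{\frac{\psi_k-tc(x,y_k)}{1-t}}\Big]d\rho(x)-\sum_{k=1}^N\psi_k\mu_k-(1-t).$$ $\nabla^{2,\perp}_{\psi,\psi}\Phi$ denotes the Hessian of $\Phi$ in $\psi$ restricted, as a quadratic form, to $\{v\in\mathbb{R}^N:\sum_k v_k=0\}$, and $\lambda_{\min}$ is its smallest eigenvalue (the minimum of $\langle v,\nabla^2_{\psi,\psi}\Phi\, v\rangle/\|v\|_2^2$ over nonzero $v$ in that subspace). *)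

theory Defs
  imports "HOL-Probability.Probability"
begin

text \<open>The points of \<open>Y\<close> are \<open>y i\<close>, for \<open>i\<close> in a finite index type with \<open>N\<close> elements, and
  \<open>\<psi>\<close> is a vector over the same index type. The values of \<open>c\<close> outside \<open>X \<times> Y\<close> are never used.\<close>

definition Lag ::
  "(real^'n) set \<Rightarrow> (real^'n \<Rightarrow> real^'n \<Rightarrow> real) \<Rightarrow> ('N::finite \<Rightarrow> real^'n) \<Rightarrow> real^'N \<Rightarrow> 'N
    \<Rightarrow> (real^'n) set" where
  "Lag X c y \<psi> i = {x \<in> X. \<forall>k. k \<noteq> i \<longrightarrow> c x (y i) - \<psi> $ i \<le> c x (y k) - \<psi> $ k}"

definition Phi ::
  "(real^'n) set \<Rightarrow> (real^'n) measure \<Rightarrow> (real^'n \<Rightarrow> real^'n \<Rightarrow> real) \<Rightarrow> ('N::finite \<Rightarrow> real^'n)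
    \<Rightarrow> real^'N \<Rightarrow> real^'N \<Rightarrow> real \<Rightarrow> real" where
  "Phi X \<rho> c y \<mu> \<psi> t =
    (LINT x:X|\<rho>. (1 - t) * ln (\<Sum>k\<in>UNIV. exp ((\<psi> $ k - t * c x (y k)) / (1 - t))))
    - (\<Sum>k\<in>UNIV. \<psi> $ k * \<mu> $ k) - (1 - t)"

text \<open>\<open>H\<close> is the derivative at \<open>x\<close> of the gradient of \<open>f\<close>, which has to exist near \<open>x\<close>.\<close>

definition has_hessian :: "(real^'N \<Rightarrow> real) \<Rightarrow> real^'N^'N \<Rightarrow> real^'N::finite \<Rightarrow> bool" where
  "has_hessian f H x \<longleftrightarrow>
    (\<exists>g. (\<forall>\<^sub>F z in nhds x. GDERIV f z :> g z) \<and> (g has_derivative (\<lambda>h. H *v h)) (at x))"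

text \<open>The infimum is taken in the extended reals so that it is \<open>\<infinity>\<close> when the index type has only
  one element and there is no nonzero \<open>v\<close>. Otherwise it is a minimum (see below).\<close>

definition lambda_min_perp :: "real^'N^'N::finite \<Rightarrow> ereal" where
  "lambda_min_perp H =
    (INF v\<in>{v::real^'N. v \<noteq> 0 \<and> (\<Sum>k\<in>UNIV. v $ k) = 0}. ereal ((v \<bullet> (H *v v)) / (norm v)\<^sup>2))"

lemma has_hessian_unique:
  assumes "has_hessian f H x" "has_hessian f H' x"
  shows "H = H'"
proof -
  obtain g g' where g: "\<forall>\<^sub>F z in nhds x. GDERIV f z :> g z" "(g has_derivative (\<lambda>h. H *v h)) (at x)"
    and g': "\<forall>\<^sub>F z in nhds x. GDERIV f z :> g' z" "(g' has_derivative (\<lambda>h. H' *v h)) (at x)"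
    using assms unfolding has_hessian_def by blast
  have eq: "\<forall>\<^sub>F z in nhds x. g z = g' z"
    using g(1) g'(1)
  proof eventually_elim
    case (elim z)
    then have "(\<lambda>h. h \<bullet> g z) = (\<lambda>h. h \<bullet> g' z)"
      unfolding gderiv_def by (rule has_derivative_unique)
    then show ?case by (metis inner_commute vector_eq_ldot)
  qed
  have ev: "\<forall>\<^sub>F z in at x. g z = g' z"
    using eq unfolding eventually_nhds_conv_at by blast
  have "g x = g' x" using eq by (rule eventually_nhds_x_imp_x)
  then have "(g' has_derivative (\<lambda>h. H *v h)) (at x)"
    using has_derivative_transform_eventually[OF g(2) ev] by simp
  then have "(\<lambda>h. H *v h) = (\<lambda>h. H' *v h)" using g'(2) by (rule has_derivative_unique)
  then show ?thesis by (metis matrix_eq)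
qed

lemma lambda_min_perp_attained:
  fixes H :: "real^'N^'N::finite"
  assumes "CARD('N) \<ge> 2"
  shows "\<exists>v. v \<noteq> 0 \<and> (\<Sum>k\<in>UNIV. v $ k) = 0 \<and>
    lambda_min_perp H = ereal ((v \<bullet> (H *v v)) / (norm v)\<^sup>2)"
proof -
  let ?q = "\<lambda>v::real^'N. v \<bullet> (H *v v)"
  let ?S = "sphere 0 1 \<inter> {v::real^'N. (\<Sum>k\<in>UNIV. v $ k) = 0}"
  have scale: "?q (a *\<^sub>R v) = a\<^sup>2 * ?q v" for a v
    by (simp add: matrix_vector_mult_scaleR power2_eq_square)
  obtain i j :: 'N where ij: "i \<noteq> j"
    using assms by (metis card_2_iff' ex_card UNIV_I)
  define w where "w = (axis i 1 - axis j 1 :: real^'N)"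
  have "w $ i \<noteq> 0" using ij by (simp add: w_def axis_def)
  then have w0: "w \<noteq> 0" by auto
  have ws: "(\<Sum>k\<in>UNIV. w $ k) = 0" by (simp add: w_def axis_def sum_subtractf)
  have normed: "(1 / norm v) *\<^sub>R v \<in> ?S" if "v \<noteq> 0" "(\<Sum>k\<in>UNIV. v $ k) = 0" for v :: "real^'N"
    using that by (simp flip: sum_distrib_left sum_divide_distrib)
  have "closed {v::real^'N. (\<Sum>k\<in>UNIV. v $ k) = 0}"
    by (intro closed_Collect_eq continuous_intros)
  then have "compact ?S" by (intro compact_Int_closed) auto
  moreover have "?S \<noteq> {}" using normed[OF w0 ws] by blast
  moreover have "continuous_on ?S ?q"
    by (intro continuous_intros linear_continuous_on matrix_vector_mul_bounded_linear)
  ultimately obtain u where u: "u \<in> ?S" "\<And>v. v \<in> ?S \<Longrightarrow> ?q u \<le> ?q v"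
    using continuous_attains_inf[of ?S ?q] by blast
  have le: "?q u \<le> ?q v / (norm v)\<^sup>2" if "v \<noteq> 0" "(\<Sum>k\<in>UNIV. v $ k) = 0" for v
    using u(2)[OF normed[OF that]] unfolding scale by (simp add: power_divide)
  have un: "u \<noteq> 0" "(\<Sum>k\<in>UNIV. u $ k) = 0" "norm u = 1" using u(1) by auto
  have "lambda_min_perp H = ereal (?q u / (norm u)\<^sup>2)"
    unfolding lambda_min_perp_def
    by (rule antisym; rule INF_lower INF_greatest) (use un le in auto)
  then show ?thesis using un by blast
qed

end

theory Submission
  imports Defs
begin

text \<open>Write \<open>\<epsilon> = 1 - t\<close> and let \<open>p(x)\<close> be the Gibbs weights of \<open>x\<close>, the softmax of the vector
  \<open>(\<psi> - t c(x, y))/\<epsilon>\<close>. Differentiating twice under the integral, the quadratic form of the Hessian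
  at \<open>v\<close> is \<open>1/\<epsilon>\<close> times the integral of the variance of \<open>v\<close> under \<open>p(x)\<close>. As \<open>t\<close> tends to one,
  \<open>p(x)\<close> concentrates on a single index at almost every \<open>x\<close>, so this variance survives only in layers
  of width \<open>\<epsilon>\<close> around the interfaces of the Laguerre cells. The bound has to show that these
  layers are thick enough to compensate the factor \<open>1/\<epsilon>\<close>.

  If \<open>v\<close> has sum zero, its values range over an interval of length at least \<open>norm v / N\<close>, so somewhere
  they leave a gap of length \<open>d\<close> at least \<open>norm v / N\<^sup>2\<close> (lemma \<open>exists_gap\<close>). The gap splits the indices
  into a set \<open>S\<close> and its complement, both nonempty. With \<open>f = \<Sum>k\<in>S. p k\<close>, the variance of \<open>v\<close> is at least
  \<open>d\<^sup>2 f (1 - f)\<close> (lemma \<open>variance_ge_of_gap\<close>), which leaves the integral of \<open>f (1 - f) / \<epsilon>\<close> to be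
  bounded below.

  This is an isoperimetric statement. The slope of \<open>f\<close> is at most a constant times \<open>f (1 - f) / \<epsilon>\<close>, so
  the \<open>L\<^sup>1\<close> Poincare inequality on the convex set \<open>X\<close> bounds the variation of \<open>f\<close> by the integral in
  question. On the other hand, \<open>f\<close> takes values in the unit interval, so its variance is \<open>A (1 - A)\<close> minus the
  integral of \<open>f (1 - f)\<close>, where \<open>A\<close> is its mean. Hence \<open>A (1 - A)\<close> is at most a constant, independent of
  \<open>t\<close>, times the integral of \<open>f (1 - f) / \<epsilon>\<close> (lemma \<open>cut_inequality\<close>). The Poincare inequality is
  used in a discrete form (lemma \<open>variance_le_of_short_steps\<close>): segments are cut into about \<open>1/\<epsilon>\<close> steps,
  along each of which the weights change by at most a constant factor, because the cost is Lipschitz.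

  Finally, \<open>A\<close> stays away from zero and one, uniformly in \<open>t\<close> and in \<open>\<psi>\<close> near \<open>\<psi>0\<close>
  (lemma \<open>gibbs_mass_lower_bound\<close>). Indeed the masses of the Laguerre cells of \<open>\<psi>0\<close> add up to one, so ties
  have mass zero and a subset of each cell of positive mass satisfies the defining inequalities with
  a margin. If \<open>\<psi>\<close> differs from \<open>\<psi>0\<close> by less than half this margin, the weight of the cell's own index is
  bounded below on that subset for every \<open>t\<close>.\<close>

section \<open>The softmax map\<close>

definition softmax :: "real^'N::finite \<Rightarrow> real^'N" where
  "softmax u = (\<chi> k. exp (u $ k) / (\<Sum>l\<in>UNIV. exp (u $ l)))"

lemma sum_exp_pos: "0 < (\<Sum>l\<in>UNIV. exp (u $ l))" for u :: "real^'N::finite"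
  by (intro sum_pos) auto

lemma softmax_pos: "0 < softmax u $ k"
  by (simp add: softmax_def sum_exp_pos)

lemma sum_softmax: "(\<Sum>k\<in>UNIV. softmax u $ k) = 1"
  using sum_exp_pos[of u] by (simp add: softmax_def flip: sum_divide_distrib)

lemma softmax_le_1: "softmax u $ k \<le> 1"
  using member_le_sum[of k UNIV "\<lambda>k. softmax u $ k"] by (simp add: sum_softmax softmax_pos less_imp_le)

lemma norm_softmax_le_1: "norm (softmax u) \<le> 1"
  using norm_le_l1_cart[of "softmax u"] by (simp add: sum_softmax softmax_pos less_imp_le)

lemma GDERIV_sum_exp:
  "GDERIV (\<lambda>u::real^'N::finite. \<Sum>l\<in>UNIV. exp (u $ l)) u :> (\<chi> k. exp (u $ k))"
  unfolding gderiv_def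
  by (auto intro!: derivative_eq_intros bounded_linear.has_derivative[OF bounded_linear_vec_nth] simp: inner_vec_def mult.commute)

lemma GDERIV_log_sum_exp:
  fixes u :: "real^'N::finite"
  shows "GDERIV (\<lambda>u. ln (\<Sum>l\<in>UNIV. exp (u $ l))) u :> softmax u"
proof (rule GDERIV_subst)
  show "GDERIV (\<lambda>u. ln (\<Sum>l\<in>UNIV. exp (u $ l))) u :>
      (1 / (\<Sum>l\<in>UNIV. exp (u $ l))) *\<^sub>R (\<chi> k. exp (u $ k))"
    using sum_exp_pos[of u]
    by (intro GDERIV_DERIV_compose GDERIV_sum_exp) (auto intro!: derivative_eq_intros)
qed (simp add: vec_eq_iff softmax_def)

lemma GDERIV_softmax:
  fixes u :: "real^'N::finite"
  shows "GDERIV (\<lambda>u. softmax u $ k) u :> (softmax u $ k) *\<^sub>R (axis k 1 - softmax u)"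
proof (rule GDERIV_subst)
  have eq: "(\<lambda>u::real^'N. softmax u $ k) = (\<lambda>u. exp (u $ k - ln (\<Sum>l\<in>UNIV. exp (u $ l))))"
    by (simp add: softmax_def exp_diff exp_ln[OF sum_exp_pos])
  have "GDERIV (\<lambda>u::real^'N. u $ k) u :> axis k 1"
    unfolding gderiv_def
    by (simp add: inner_axis bounded_linear_imp_has_derivative bounded_linear_vec_nth)
  then show "GDERIV (\<lambda>u. softmax u $ k) u :>
      exp (u $ k - ln (\<Sum>l\<in>UNIV. exp (u $ l))) *\<^sub>R (axis k 1 - softmax u)"
    unfolding eq by (intro GDERIV_DERIV_compose GDERIV_diff GDERIV_log_sum_exp)
      (auto intro!: derivative_eq_intros)
  show "exp (u $ k - ln (\<Sum>l\<in>UNIV. exp (u $ l))) *\<^sub>R (axis k 1 - softmax u)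
      = (softmax u $ k) *\<^sub>R (axis k 1 - softmax u)"
    by (simp add: fun_cong[OF eq, of u])
qed

lemma norm_grad_softmax_le: "norm ((softmax u $ k) *\<^sub>R (axis k 1 - softmax u)) \<le> 2"
proof -
  have "norm (axis k 1 - softmax u) \<le> 2"
    using norm_triangle_ineq4[of "axis k 1" "softmax u"] norm_softmax_le_1[of u] by simp
  then have "\<bar>softmax u $ k\<bar> * norm (axis k 1 - softmax u) \<le> 1 * 2"
    by (intro mult_mono) (use softmax_le_1[of u k] softmax_pos[of u k] in auto)
  then show ?thesis by simp
qed

lemma GDERIV_bounded_imp_Lipschitz:
  fixes f :: "'v::euclidean_space \<Rightarrow> real"
  assumes "\<And>u. GDERIV f u :> g u" "\<And>u. norm (g u) \<le> B"
  shows "\<bar>f u - f w\<bar> \<le> B * norm (u - w)"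
proof -
  have "norm (f u - f w) \<le> B * norm (u - w)"
  proof (rule differentiable_bound[of UNIV f "\<lambda>x h. h \<bullet> g x"])
    fix x show "(f has_derivative (\<lambda>h. h \<bullet> g x)) (at x within UNIV)"
      using assms(1)[of x] by (simp add: gderiv_def)
    show "onorm (\<lambda>h. h \<bullet> g x) \<le> B"
    proof (rule onorm_le)
      fix h
      have "norm (h \<bullet> g x) \<le> norm h * norm (g x)" using Cauchy_Schwarz_ineq2 by simp
      also have "\<dots> \<le> norm h * B" by (intro mult_left_mono assms(2)) auto
      finally show "norm (h \<bullet> g x) \<le> B * norm h" by (simp add: mult.commute)
    qed
  qed auto
  then show ?thesis by simp
qed

lemma softmax_nth_Lipschitz: "\<bar>softmax u $ k - softmax w $ k\<bar> \<le> 2 * norm (u - w)"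
  by (rule GDERIV_bounded_imp_Lipschitz[OF GDERIV_softmax norm_grad_softmax_le])

lemma softmax_Lipschitz:
  "norm (softmax u - softmax w) \<le> 2 * real CARD('N) * norm (u - w)" for u w :: "real^'N::finite"
proof -
  have "norm (softmax u - softmax w) \<le> (\<Sum>k\<in>UNIV. \<bar>softmax u $ k - softmax w $ k\<bar>)"
    using norm_le_l1_cart[of "softmax u - softmax w"] by simp
  also have "\<dots> \<le> (\<Sum>k\<in>(UNIV::'N set). 2 * norm (u - w))"
    by (intro sum_mono softmax_nth_Lipschitz)
  finally show ?thesis by (simp add: mult_ac)
qed

lemma continuous_softmax: "continuous_on UNIV (softmax :: real^'N::finite \<Rightarrow> real^'N)"
  by (rule lipschitz_on_continuous_on[where L="2 * real CARD('N)"])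
    (auto simp: lipschitz_on_def dist_norm intro!: softmax_Lipschitz)

text \<open>A Lipschitz bound for the gradient of each component is what differentiation of the integrated weights
  under the integral sign uses, just as \<open>softmax_Lipschitz\<close> serves for the integrated logarithm of the sum of exponentials.\<close>

lemma grad_softmax_Lipschitz:
  fixes u w :: "real^'N::finite"
  shows "norm ((softmax u $ k) *\<^sub>R (axis k 1 - softmax u) - (softmax w $ k) *\<^sub>R (axis k 1 - softmax w))
    \<le> (4 + 2 * real CARD('N)) * norm (u - w)"
proof -
  let ?p = "softmax u" and ?q = "softmax w"
  have "(?p $ k) *\<^sub>R (axis k 1 - ?p) - (?q $ k) *\<^sub>R (axis k 1 - ?q)
      = (?p $ k - ?q $ k) *\<^sub>R (axis k 1 - ?p) - (?q $ k) *\<^sub>R (?p - ?q)"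
    by (simp add: algebra_simps)
  also have "norm \<dots> \<le> \<bar>?p $ k - ?q $ k\<bar> * norm (axis k 1 - ?p) + \<bar>?q $ k\<bar> * norm (?p - ?q)"
    using norm_triangle_ineq4[of "(?p $ k - ?q $ k) *\<^sub>R (axis k 1 - ?p)" "(?q $ k) *\<^sub>R (?p - ?q)"] by simp
  also have "\<dots> \<le> (2 * norm (u - w)) * 2 + 1 * (2 * real CARD('N) * norm (u - w))"
  proof (intro add_mono mult_mono softmax_nth_Lipschitz softmax_Lipschitz)
    show "norm (axis k 1 - ?p) \<le> 2"
      using norm_triangle_ineq4[of "axis k 1" ?p] norm_softmax_le_1[of u] by simp
    show "\<bar>?q $ k\<bar> \<le> 1" using softmax_le_1[of w k] softmax_pos[of w k] by simp
  qed auto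
  finally show ?thesis by (simp add: algebra_simps)
qed

text \<open>The numerator and the normalising sum each change by at most a factor \<open>exp d\<close>, hence the \<open>2 * d\<close>.\<close>

lemma softmax_le_exp_mult:
  fixes u w :: "real^'N::finite"
  assumes "\<And>k. \<bar>u $ k - w $ k\<bar> \<le> d"
  shows "softmax u $ k \<le> exp (2 * d) * softmax w $ k"
proof -
  have "exp (u $ k) \<le> exp d * exp (w $ k)" for k
    using assms[of k] by (simp flip: exp_add add: abs_le_iff)
  moreover have "exp (w $ k) \<le> exp d * exp (u $ k)" for k
    using assms[of k] by (simp flip: exp_add add: abs_le_iff)
  then have "(\<Sum>l\<in>UNIV. exp (w $ l)) \<le> exp d * (\<Sum>l\<in>UNIV. exp (u $ l))"
    unfolding sum_distrib_left by (rule sum_mono)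
  ultimately have "exp (u $ k) * (\<Sum>l\<in>UNIV. exp (w $ l)) \<le> (exp d * exp (w $ k)) * (exp d * (\<Sum>l\<in>UNIV. exp (u $ l)))"
    by (intro mult_mono) (auto simp: sum_nonneg)
  moreover have "exp (2 * d) = exp d * exp d" by (simp flip: exp_add)
  ultimately show ?thesis
    unfolding softmax_def using sum_exp_pos[of u] sum_exp_pos[of w] by (simp add: field_simps)
qed

text \<open>The difference is \<open>f u (1 - f w) - (1 - f u) f w\<close>. Both products are nonnegative, and each is
  within a constant factor of \<open>f w (1 - f w)\<close> because the weights of \<open>S\<close> and those of its complement
  change by a bounded factor.\<close>

lemma softmax_cut_diff_le:
  fixes u w :: "real^'N::finite" and S :: "'N set"
  assumes d: "\<And>k. \<bar>u $ k - w $ k\<bar> \<le> d"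
  defines "f \<equiv> \<lambda>u. \<Sum>k\<in>S. softmax u $ k"
  shows "\<bar>f u - f w\<bar> \<le> exp (2 * d) * (f w * (1 - f w))"
proof -
  have compl: "1 - f u = (\<Sum>k\<in>-S. softmax u $ k)" for u
    using sum.subset_diff[of S UNIV "\<lambda>k. softmax u $ k"] by (simp add: f_def sum_softmax Compl_eq_Diff_UNIV)
  have f0: "0 \<le> f u" "0 \<le> 1 - f u" for u
    unfolding compl by (auto simp: f_def intro!: sum_nonneg less_imp_le[OF softmax_pos])
  have 1: "f u \<le> exp (2 * d) * f w"
    unfolding f_def sum_distrib_left by (intro sum_mono softmax_le_exp_mult d)
  have 2: "1 - f u \<le> exp (2 * d) * (1 - f w)"
    unfolding compl sum_distrib_left by (intro sum_mono softmax_le_exp_mult d)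
  have "f u - f w = f u * (1 - f w) - (1 - f u) * f w" by (simp add: algebra_simps)
  moreover have "f u * (1 - f w) \<le> exp (2 * d) * f w * (1 - f w)"
    by (rule mult_right_mono[OF 1 f0(2)])
  moreover have "(1 - f u) * f w \<le> exp (2 * d) * (1 - f w) * f w"
    by (rule mult_right_mono[OF 2 f0(1)])
  moreover have "0 \<le> f u * (1 - f w)" "0 \<le> (1 - f u) * f w" using f0 by simp_all
  ultimately show ?thesis by (simp add: abs_le_iff mult_ac)
qed

section \<open>Differentiation under the integral sign\<close>

lemma integrable_compose_bounded:
  fixes G :: "'v::euclidean_space \<Rightarrow> 'w::euclidean_space" and b :: "'a \<Rightarrow> 'v"
  assumes "finite_measure M" and b[measurable]: "b \<in> borel_measurable M"
    and B: "\<And>x. norm (b x) \<le> B" and G: "continuous_on UNIV G"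
  shows "integrable M (\<lambda>x. G (w - b x))"
proof -
  interpret finite_measure M by fact
  have "compact (G ` cball 0 (norm w + B))"
    by (intro compact_continuous_image continuous_on_subset[OF G]) auto
  then obtain C where C: "\<And>u. u \<in> cball 0 (norm w + B) \<Longrightarrow> norm (G u) \<le> C"
    by (meson compact_imp_bounded bounded_iff imageI)
  have "norm (w - b x) \<le> norm w + B" for x
    using norm_triangle_ineq4[of w "b x"] B[of x] by simp
  then have "norm (G (w - b x)) \<le> C" for x by (intro C) simp
  moreover have "(\<lambda>x. G (w - b x)) \<in> borel_measurable M"
    by (rule borel_measurable_continuous_on[OF G]) simp
  ultimately show ?thesis by (intro integrable_const_bound[where B=C]) auto
qed

lemma first_order_remainder_le:
  fixes G :: "'v::euclidean_space \<Rightarrow> real"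
  assumes "\<And>u. GDERIV G u :> g u" "\<And>u w. norm (g u - g w) \<le> K * norm (u - w)" "0 \<le> K"
  shows "\<bar>G w - G u - (w - u) \<bullet> g u\<bar> \<le> K * (norm (w - u))\<^sup>2"
proof -
  have "norm (G w - G u - (w - u) \<bullet> g u) \<le> norm (w - u) * (K * norm (w - u))"
  proof (rule differentiable_bound_linearization[where f=G and f'="\<lambda>x h. h \<bullet> g x"
        and S="cball u (norm (w - u))"])
    fix x assume x: "x \<in> cball u (norm (w - u))"
    show "(G has_derivative (\<lambda>h. h \<bullet> g x)) (at x within cball u (norm (w - u)))"
      using assms(1)[of x] has_derivative_at_withinI by (auto simp: gderiv_def)
    have gx: "norm (g x - g u) \<le> K * norm (w - u)"
      using x by (intro order_trans[OF assms(2)] mult_left_mono assms(3)) (auto simp: dist_norm norm_minus_commute)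
    show "onorm ((\<lambda>h. h \<bullet> g x) - (\<lambda>h. h \<bullet> g u)) \<le> K * norm (w - u)"
    proof (rule onorm_le)
      fix h
      have "norm (((\<lambda>h. h \<bullet> g x) - (\<lambda>h. h \<bullet> g u)) h) \<le> norm h * norm (g x - g u)"
        using Cauchy_Schwarz_ineq2[of h "g x - g u"] by (simp add: inner_diff_right)
      also have "\<dots> \<le> norm h * (K * norm (w - u))" by (intro mult_left_mono gx) auto
      finally show "norm (((\<lambda>h. h \<bullet> g x) - (\<lambda>h. h \<bullet> g u)) h) \<le> K * norm (w - u) * norm h"
        by (simp add: mult.commute)
    qed
  next
    fix s :: real assume "s \<in> {0..1}"
    then show "u + s *\<^sub>R (w - u) \<in> cball u (norm (w - u))"
      by (simp add: dist_norm mult_left_le_one_le)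
  qed simp
  then show ?thesis by (simp add: power2_eq_square mult_ac)
qed

text \<open>Since the gradient is Lipschitz, the remainder of the first-order expansion is quadratic in the
  increment, uniformly in the integration variable. Integrating it gives a quadratic remainder for the
  integral. The integrand has the affine argument
  \<open>s \<phi> - b x\<close> because \<open>\<psi>\<close> and the cost enter \<open>\<Phi>\<close> only through \<open>(\<psi> - t c)/(1 - t)\<close>.\<close>

lemma GDERIV_integral_affine:
  fixes G :: "'v::euclidean_space \<Rightarrow> real" and b :: "'a \<Rightarrow> 'v"
  assumes M: "finite_measure M" and b: "b \<in> borel_measurable M" "\<And>x. norm (b x) \<le> B"
    and G: "\<And>u. GDERIV G u :> g u"
    and Lip: "\<And>u w. norm (g u - g w) \<le> K * norm (u - w)" and K: "0 \<le> K"
  shows "GDERIV (\<lambda>\<phi>. \<integral>x. G (s *\<^sub>R \<phi> - b x) \<partial>M) \<phi> :> s *\<^sub>R (\<integral>x. g (s *\<^sub>R \<phi> - b x) \<partial>M)"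
proof -
  interpret finite_measure M by fact
  have "continuous_on UNIV G"
    using G by (auto simp: gderiv_def intro!: has_derivative_continuous_on[of UNIV G "\<lambda>x h. h \<bullet> g x"])
  note intG = integrable_compose_bounded[OF M b this]
  have "continuous_on UNIV g"
    by (rule lipschitz_on_continuous_on[where L=K])
      (use Lip K in \<open>auto simp: lipschitz_on_def dist_norm\<close>)
  note intg = integrable_compose_bounded[OF M b this]
  let ?J = "s *\<^sub>R (\<integral>x. g (s *\<^sub>R \<phi> - b x) \<partial>M)"
  let ?C = "K * s\<^sup>2 * measure M (space M)"
  have rem: "\<bar>(\<integral>x. G (s *\<^sub>R z - b x) \<partial>M) - (\<integral>x. G (s *\<^sub>R \<phi> - b x) \<partial>M) - (z - \<phi>) \<bullet> ?J\<bar>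
      \<le> ?C * (norm (z - \<phi>))\<^sup>2" for z
  proof -
    let ?R = "\<lambda>x. G (s *\<^sub>R z - b x) - G (s *\<^sub>R \<phi> - b x) - (s *\<^sub>R (z - \<phi>)) \<bullet> g (s *\<^sub>R \<phi> - b x)"
    have i: "integrable M (\<lambda>x. (s *\<^sub>R (z - \<phi>)) \<bullet> g (s *\<^sub>R \<phi> - b x))"
      by (intro integrable_inner_right intg)
    have "(\<integral>x. (s *\<^sub>R (z - \<phi>)) \<bullet> g (s *\<^sub>R \<phi> - b x) \<partial>M) = (z - \<phi>) \<bullet> ?J"
      by (subst integral_inner_right) (auto intro: intg)
    then have "(\<integral>x. ?R x \<partial>M) = (\<integral>x. G (s *\<^sub>R z - b x) \<partial>M) - (\<integral>x. G (s *\<^sub>R \<phi> - b x) \<partial>M) - (z - \<phi>) \<bullet> ?J"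
      by (simp add: intG i del: inner_scaleR_left)
    moreover have "\<bar>\<integral>x. ?R x \<partial>M\<bar> \<le> (\<integral>x. K * s\<^sup>2 * (norm (z - \<phi>))\<^sup>2 \<partial>M)"
    proof (rule integral_abs_bound[THEN order_trans], rule integral_mono)
      fix x
      have d: "s *\<^sub>R z - b x - (s *\<^sub>R \<phi> - b x) = s *\<^sub>R (z - \<phi>)" by (simp add: algebra_simps)
      show "\<bar>?R x\<bar> \<le> K * s\<^sup>2 * (norm (z - \<phi>))\<^sup>2"
        using first_order_remainder_le[OF G Lip K, of "s *\<^sub>R z - b x" "s *\<^sub>R \<phi> - b x"]
        unfolding d by (simp add: power_mult_distrib mult.assoc)
    qed (use intG i in auto)
    ultimately show ?thesis by (simp add: mult_ac)
  qed
  show ?thesis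
    unfolding gderiv_def
  proof (rule has_derivativeI_sandwich[where e=1 and H="\<lambda>z. ?C * norm (z - \<phi>)"])
    show "bounded_linear (\<lambda>h. h \<bullet> ?J)" by (rule bounded_linear_inner_left)
    show "((\<lambda>z. ?C * norm (z - \<phi>)) \<longlongrightarrow> 0) (at \<phi>)"
      by (auto intro!: tendsto_eq_intros)
    fix z assume "z \<noteq> \<phi>"
    then show "norm ((\<integral>x. G (s *\<^sub>R z - b x) \<partial>M) - (\<integral>x. G (s *\<^sub>R \<phi> - b x) \<partial>M) - (z - \<phi>) \<bullet> ?J)
        / norm (z - \<phi>) \<le> ?C * norm (z - \<phi>)"
      using rem[of z] by (simp add: divide_le_eq power2_eq_square mult_ac)
  qed simp
qed

section \<open>A discrete Poincare inequality on a convex set\<close>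

lemma nn_integral_lborel_scale:
  fixes g :: "'a::euclidean_space \<Rightarrow> ennreal"
  assumes [measurable]: "g \<in> borel_measurable borel" and "0 < c"
  shows "(\<integral>\<^sup>+x. g x \<partial>lborel) = ennreal (c ^ DIM('a)) * (\<integral>\<^sup>+x. g (t + c *\<^sub>R x) \<partial>lborel)"
proof -
  have "(\<integral>\<^sup>+x. g x \<partial>lborel)
      = (\<integral>\<^sup>+x. g x \<partial>density (distr lborel borel (\<lambda>x. t + c *\<^sub>R x)) (\<lambda>_. ennreal (\<bar>c\<bar> ^ DIM('a))))"
    using assms(2) by (intro arg_cong[where f="\<lambda>N. nn_integral N g"] lborel_affine) simp
  also have "\<dots> = (\<integral>\<^sup>+x. ennreal (c ^ DIM('a)) * g (t + c *\<^sub>R x) \<partial>lborel)"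
    using assms(2) by (subst nn_integral_density) (auto simp: nn_integral_distr)
  also have "\<dots> = ennreal (c ^ DIM('a)) * (\<integral>\<^sup>+x. g (t + c *\<^sub>R x) \<partial>lborel)"
    by (subst nn_integral_cmult) auto
  finally show ?thesis .
qed

text \<open>The chain stops at the midpoint: all its points then keep at least half of their weight on the endpoint \<open>x\<close>,
  which is what bounds the Jacobian in the change of variables of \<open>nn_integral_contraction_le\<close>.\<close>

lemma abs_diff_le_sum_along_segment:
  fixes f :: "'a::real_normed_vector \<Rightarrow> real" and h :: real
  assumes cX: "convex X" and M: "0 < (M::nat)"
    and step: "\<And>x z. x \<in> X \<Longrightarrow> z \<in> X \<Longrightarrow> norm (z - x) \<le> h \<Longrightarrow> \<bar>f z - f x\<bar> \<le> g x"
    and x: "x \<in> X" and y: "y \<in> X" and xy: "norm (y - x) \<le> 2 * M * h"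
  shows "\<bar>f ((1/2) *\<^sub>R x + (1/2) *\<^sub>R y) - f x\<bar>
    \<le> (\<Sum>j<M. g ((1 - real j / (2 * real M)) *\<^sub>R x + (real j / (2 * real M)) *\<^sub>R y))"
proof -
  define z where "z j = (1 - real j / (2 * real M)) *\<^sub>R x + (real j / (2 * real M)) *\<^sub>R y" for j
  have zX: "z j \<in> X" if "j \<le> M" for j
  proof -
    have "real j / (2 * real M) \<le> 1" using that M by (simp add: field_simps)
    moreover have "0 \<le> real j / (2 * real M)" by simp
    ultimately show ?thesis using cX x y unfolding z_def convex_alt by blast
  qed
  have "real M / (2 * real M) = 1/2" using M by simp
  then have zM: "z M = (1/2) *\<^sub>R x + (1/2) *\<^sub>R y" unfolding z_def using M by simp
  have z0: "z 0 = x" by (simp add: z_def)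
  have "f (z M) - f (z 0) = (\<Sum>j<M. f (z (Suc j)) - f (z j))"
    by (rule sum_lessThan_telescope[symmetric])
  also have "\<bar>\<dots>\<bar> \<le> (\<Sum>j<M. \<bar>f (z (Suc j)) - f (z j)\<bar>)" by (rule sum_abs)
  also have "\<dots> \<le> (\<Sum>j<M. g (z j))"
  proof (rule sum_mono, rule step)
    fix j assume j: "j \<in> {..<M}"
    then show "z j \<in> X" "z (Suc j) \<in> X" by (simp_all add: zX)
    have "z (Suc j) - z j = (real (Suc j) / (2 * real M) - real j / (2 * real M)) *\<^sub>R (y - x)"
      unfolding z_def by (simp only: scaleR_diff_left scaleR_diff_right scaleR_one) simp
    also have "real (Suc j) / (2 * real M) - real j / (2 * real M) = 1 / (2 * real M)"
      by (simp flip: diff_divide_distrib)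
    finally have "norm (z (Suc j) - z j) = norm (y - x) / (2 * real M)" by simp
    then show "norm (z (Suc j) - z j) \<le> h" using xy M by (simp add: divide_le_eq mult_ac)
  qed
  finally show ?thesis unfolding zM z0 unfolding z_def .
qed

locale density_on_convex = prob_space \<rho> for \<rho> :: "'a::euclidean_space measure" +
  fixes X :: "'a set" and r :: "'a \<Rightarrow> real" and m_lo m_hi :: real
  assumes X_borel[measurable]: "X \<in> sets borel" and convex_X: "convex X"
    and r_borel[measurable]: "r \<in> borel_measurable borel"
    and density: "\<rho> = density lborel (\<lambda>x. ennreal (r x) * indicator X x)"
    and lo_pos: "0 < m_lo" and r_bounds: "\<And>x. x \<in> X \<Longrightarrow> m_lo \<le> r x \<and> r x \<le> m_hi"
begin

lemma sets_rho[measurable_cong]: "sets \<rho> = sets borel"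
  by (simp add: density)

lemma space_rho: "space \<rho> = UNIV"
  by (simp add: density)

lemma AE_in_X: "AE x in \<rho>. x \<in> X"
  by (subst density, subst AE_density) (auto simp: indicator_def)

lemma hi_pos: "0 < m_hi"
proof -
  have "X \<noteq> {}" using AE_in_X AE_False by fastforce
  then show ?thesis using r_bounds lo_pos by fastforce
qed

text \<open>The map \<open>x \<mapsto> (1 - s) x + s y\<close> sends the convex set \<open>X\<close> into itself and shrinks volumes by the factor
  \<open>(1 - s)^n\<close>, at least \<open>2^-n\<close>. Replacing the density by its bounds costs the factor \<open>m_hi / m_lo\<close>.\<close>

lemma nn_integral_contraction_le:
  fixes g :: "'a \<Rightarrow> ennreal"
  assumes g[measurable]: "g \<in> borel_measurable borel"
    and s: "0 \<le> s" "s \<le> 1/2" and y: "y \<in> X"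
  shows "(\<integral>\<^sup>+x. g ((1 - s) *\<^sub>R x + s *\<^sub>R y) \<partial>\<rho>) \<le> ennreal (2 ^ DIM('a) * m_hi / m_lo) * (\<integral>\<^sup>+x. g x \<partial>\<rho>)"
proof -
  let ?n = "DIM('a)"
  let ?I = "\<integral>\<^sup>+x. indicator X x * g x \<partial>lborel"
  let ?z = "\<lambda>x. (1 - s) *\<^sub>R x + s *\<^sub>R y"
  have "(\<integral>\<^sup>+x. g (?z x) \<partial>\<rho>) = (\<integral>\<^sup>+x. ennreal (r x) * indicator X x * g (?z x) \<partial>lborel)"
    unfolding density by (subst nn_integral_density) auto
  also have "\<dots> \<le> (\<integral>\<^sup>+x. ennreal m_hi * (indicator X (?z x) * g (?z x)) \<partial>lborel)"
  proof (intro nn_integral_mono)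
    fix x
    show "ennreal (r x) * indicator X x * g (?z x) \<le> ennreal m_hi * (indicator X (?z x) * g (?z x))"
    proof (cases "x \<in> X")
      case True
      then have "?z x \<in> X" using convex_X y s by (auto simp: convex_alt)
      then show ?thesis using True r_bounds[OF True] by (auto intro!: mult_right_mono ennreal_leI)
    qed simp
  qed
  also have "\<dots> = ennreal m_hi * (\<integral>\<^sup>+x. indicator X (?z x) * g (?z x) \<partial>lborel)"
    by (subst nn_integral_cmult) auto
  also have "(\<integral>\<^sup>+x. indicator X (?z x) * g (?z x) \<partial>lborel) \<le> ennreal (2 ^ ?n) * ?I"
  proof -
    have "?I = ennreal ((1 - s) ^ ?n) * (\<integral>\<^sup>+x. indicator X (s *\<^sub>R y + (1 - s) *\<^sub>R x) * g (s *\<^sub>R y + (1 - s) *\<^sub>R x) \<partial>lborel)"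
      by (rule nn_integral_lborel_scale) (use s in auto)
    also have "\<dots> = ennreal ((1 - s) ^ ?n) * (\<integral>\<^sup>+x. indicator X (?z x) * g (?z x) \<partial>lborel)"
      by (simp add: add.commute)
    finally have eq: "ennreal (2 ^ ?n) * ?I
        = ennreal (2 ^ ?n * (1 - s) ^ ?n) * (\<integral>\<^sup>+x. indicator X (?z x) * g (?z x) \<partial>lborel)"
      using s by (simp add: ennreal_mult mult.assoc)
    have "1 \<le> (2 * (1 - s)) ^ ?n" using s by (intro one_le_power) auto
    then have "ennreal 1 \<le> ennreal (2 ^ ?n * (1 - s) ^ ?n)"
      by (intro ennreal_leI) (simp only: power_mult_distrib)
    from mult_right_mono[OF this, of "\<integral>\<^sup>+x. indicator X (?z x) * g (?z x) \<partial>lborel"]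
    show ?thesis unfolding eq by simp
  qed
  also have "?I \<le> ennreal (1 / m_lo) * (\<integral>\<^sup>+x. g x \<partial>\<rho>)"
  proof -
    have "?I \<le> (\<integral>\<^sup>+x. ennreal (1 / m_lo) * (ennreal (r x) * indicator X x * g x) \<partial>lborel)"
    proof (intro nn_integral_mono)
      fix x
      have "1 \<le> ennreal (1 / m_lo) * ennreal (r x)" if "x \<in> X"
        using r_bounds[OF that] lo_pos by (simp flip: ennreal_mult' add: field_simps)
      from mult_right_mono[OF this, of "g x"]
      show "indicator X x * g x \<le> ennreal (1 / m_lo) * (ennreal (r x) * indicator X x * g x)"
        by (cases "x \<in> X") (auto simp: mult_ac)
    qed
    also have "\<dots> = ennreal (1 / m_lo) * (\<integral>\<^sup>+x. g x \<partial>\<rho>)"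
      unfolding density by (simp add: nn_integral_cmult nn_integral_density)
    finally show ?thesis .
  qed
  finally have "(\<integral>\<^sup>+x. g (?z x) \<partial>\<rho>) \<le> ennreal m_hi * (ennreal (2 ^ ?n) * (ennreal (1 / m_lo) * (\<integral>\<^sup>+x. g x \<partial>\<rho>)))"
    by (simp add: mult_left_mono)
  also have "\<dots> = ennreal (2 ^ ?n * m_hi / m_lo) * (\<integral>\<^sup>+x. g x \<partial>\<rho>)"
  proof -
    have "2 ^ ?n * m_hi / m_lo = m_hi * (2 ^ ?n * (1 / m_lo))" by simp
    then have "ennreal (2 ^ ?n * m_hi / m_lo) = ennreal m_hi * (ennreal (2 ^ ?n) * ennreal (1 / m_lo))"
      using hi_pos lo_pos by (simp flip: ennreal_mult)
    then show ?thesis by (simp only: mult.assoc)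
  qed
  finally show ?thesis .
qed

text \<open>The double integral of \<open>(f x - f y)\<^sup>2\<close> is twice the variance, and it is at most that of
  \<open>\<bar>f x - f y\<bar>\<close> since \<open>f\<close> takes values in the unit interval. The segment from \<open>x\<close> to \<open>y\<close> is cut at its
  midpoint and each half into \<open>M\<close> steps of length at most \<open>h\<close>. Each step contributes the mean of \<open>g\<close> up to the
  constant of \<open>nn_integral_contraction_le\<close>, and the second half is the first one with \<open>x\<close> and \<open>y\<close> exchanged.\<close>

lemma variance_le_of_short_steps:
  fixes f g :: "'a \<Rightarrow> real" and h :: real
  assumes f[measurable]: "f \<in> borel_measurable borel" and f01: "\<And>x. 0 \<le> f x" "\<And>x. f x \<le> 1"
    and g[measurable]: "g \<in> borel_measurable borel" and g0B: "\<And>x. 0 \<le> g x" "\<And>x. g x \<le> B"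
    and M: "0 < (M::nat)" and diam: "\<And>x z. x \<in> X \<Longrightarrow> z \<in> X \<Longrightarrow> norm (z - x) \<le> 2 * M * h"
    and step: "\<And>x z. x \<in> X \<Longrightarrow> z \<in> X \<Longrightarrow> norm (z - x) \<le> h \<Longrightarrow> \<bar>f z - f x\<bar> \<le> g x"
  shows "(\<integral>x. (f x)\<^sup>2 \<partial>\<rho>) - (\<integral>x. f x \<partial>\<rho>)\<^sup>2 \<le> 2 ^ DIM('a) * m_hi / m_lo * M * (\<integral>x. g x \<partial>\<rho>)"
proof -
  interpret P: pair_prob_space \<rho> \<rho> ..
  define K where "K = 2 ^ DIM('a) * m_hi / m_lo"
  have K: "0 < K" using hi_pos lo_pos by (simp add: K_def)
  define G where "G = (\<integral>x. g x \<partial>\<rho>)"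
  have G0: "0 \<le> G" using g0B by (simp add: G_def)
  have ig: "integrable \<rho> g" by (rule integrable_const_bound[where B=B]) (use g0B in auto)
  have if1: "integrable \<rho> f" by (rule integrable_const_bound[where B=1]) (use f01 in auto)
  have if2: "integrable \<rho> (\<lambda>x. (f x)\<^sup>2)"
    by (rule integrable_const_bound[where B=1]) (use f01 in \<open>auto simp: power_le_one\<close>)
  define A where "A = (\<integral>x. f x \<partial>\<rho>)"
  define Q where "Q = (\<integral>x. (f x)\<^sup>2 \<partial>\<rho>)"
  let ?s = "\<lambda>j. real j / (2 * real M)"
  have contr: "(\<integral>\<^sup>+x. ennreal (g ((1 - ?s j) *\<^sub>R x + ?s j *\<^sub>R y)) \<partial>\<rho>) \<le> ennreal (K * G)"
    if "y \<in> X" "j < M" for y j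
  proof -
    have "?s j \<le> 1/2" using that(2) by (simp add: field_simps)
    then have "(\<integral>\<^sup>+x. ennreal (g ((1 - ?s j) *\<^sub>R x + ?s j *\<^sub>R y)) \<partial>\<rho>) \<le> ennreal K * (\<integral>\<^sup>+x. ennreal (g x) \<partial>\<rho>)"
      unfolding K_def
      by (intro nn_integral_contraction_le) (use that in auto)
    also have "(\<integral>\<^sup>+x. ennreal (g x) \<partial>\<rho>) = ennreal G"
      unfolding G_def by (rule nn_integral_eq_integral) (use ig g0B in auto)
    finally show ?thesis using K by (simp add: ennreal_mult')
  qed
  have half: "(\<integral>\<^sup>+y. \<integral>\<^sup>+x. (\<Sum>j<M. ennreal (g ((1 - ?s j) *\<^sub>R x + ?s j *\<^sub>R y))) \<partial>\<rho> \<partial>\<rho>) \<le> ennreal (M * (K * G))"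
  proof -
    have "(\<integral>\<^sup>+y. \<integral>\<^sup>+x. (\<Sum>j<M. ennreal (g ((1 - ?s j) *\<^sub>R x + ?s j *\<^sub>R y))) \<partial>\<rho> \<partial>\<rho>)
        = (\<integral>\<^sup>+y. (\<Sum>j<M. \<integral>\<^sup>+x. ennreal (g ((1 - ?s j) *\<^sub>R x + ?s j *\<^sub>R y)) \<partial>\<rho>) \<partial>\<rho>)"
      by (subst nn_integral_sum) auto
    also have "\<dots> \<le> (\<integral>\<^sup>+y. (\<Sum>j<M. ennreal (K * G)) \<partial>\<rho>)"
      by (rule nn_integral_mono_AE, rule eventually_mono[OF AE_in_X], rule sum_mono, rule contr) auto
    also have "\<dots> = ennreal (M * (K * G))"
      using K G0 by (simp add: emeasure_space_1 ennreal_mult ennreal_of_nat_eq_real_of_nat)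
    finally show ?thesis .
  qed
  have sq: "ennreal ((f x - f y)\<^sup>2) \<le> (\<Sum>j<M. ennreal (g ((1 - ?s j) *\<^sub>R x + ?s j *\<^sub>R y)))
      + (\<Sum>j<M. ennreal (g ((1 - ?s j) *\<^sub>R y + ?s j *\<^sub>R x)))" if "x \<in> X" "y \<in> X" for x y
  proof -
    have seg: "\<bar>f ((1/2) *\<^sub>R a + (1/2) *\<^sub>R b) - f a\<bar> \<le> (\<Sum>j<M. g ((1 - ?s j) *\<^sub>R a + ?s j *\<^sub>R b))"
      if "a \<in> X" "b \<in> X" for a b
      by (rule abs_diff_le_sum_along_segment[OF convex_X M step that diam[OF that]])
    have "\<bar>f x - f y\<bar> \<le> 1" using f01[of x] f01[of y] by auto
    then have "\<bar>f x - f y\<bar>\<^sup>2 \<le> \<bar>f x - f y\<bar>" by (simp add: power2_eq_square mult_left_le_one_le del: abs_mult_self_eq)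
    then have "(f x - f y)\<^sup>2 \<le> \<bar>f x - f y\<bar>" by simp
    also have "\<dots> \<le> \<bar>f ((1/2) *\<^sub>R x + (1/2) *\<^sub>R y) - f x\<bar> + \<bar>f ((1/2) *\<^sub>R y + (1/2) *\<^sub>R x) - f y\<bar>"
      by (simp add: add.commute)
    also have "\<dots> \<le> (\<Sum>j<M. g ((1 - ?s j) *\<^sub>R x + ?s j *\<^sub>R y)) + (\<Sum>j<M. g ((1 - ?s j) *\<^sub>R y + ?s j *\<^sub>R x))"
      by (intro add_mono seg that)
    finally have "ennreal ((f x - f y)\<^sup>2) \<le> ennreal \<dots>" by (rule ennreal_leI)
    also have "\<dots> = (\<Sum>j<M. ennreal (g ((1 - ?s j) *\<^sub>R x + ?s j *\<^sub>R y)))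
      + (\<Sum>j<M. ennreal (g ((1 - ?s j) *\<^sub>R y + ?s j *\<^sub>R x)))"
      by (subst ennreal_plus) (use g0B(1) in \<open>simp_all add: sum_nonneg sum_ennreal\<close>)
    finally show ?thesis .
  qed
  have inner: "(\<integral>\<^sup>+x. ennreal ((f x - f y)\<^sup>2) \<partial>\<rho>) = ennreal (Q - 2 * f y * A + (f y)\<^sup>2)" for y
  proof -
    have i: "integrable \<rho> (\<lambda>x. (f x - f y)\<^sup>2)"
      unfolding power2_diff using if1 if2 by auto
    have "(\<integral>x. (f x - f y)\<^sup>2 \<partial>\<rho>) = Q - 2 * f y * A + (f y)\<^sup>2"
      unfolding power2_diff Q_def A_def using if1 if2 by (simp add: prob_space algebra_simps)
    then show ?thesis using nn_integral_eq_integral[OF i] by simp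
  qed
  have nonneg: "0 \<le> Q - 2 * f y * A + (f y)\<^sup>2" for y
  proof -
    have "(\<integral>x. (f x - f y)\<^sup>2 \<partial>\<rho>) = Q - 2 * f y * A + (f y)\<^sup>2"
      unfolding power2_diff Q_def A_def using if1 if2 by (simp add: prob_space algebra_simps)
    then show ?thesis using integral_nonneg_AE[of "\<lambda>x. (f x - f y)\<^sup>2" \<rho>] by simp
  qed
  have "(\<integral>\<^sup>+y. \<integral>\<^sup>+x. ennreal ((f x - f y)\<^sup>2) \<partial>\<rho> \<partial>\<rho>) = ennreal (2 * Q - 2 * A\<^sup>2)"
  proof -
    have i: "integrable \<rho> (\<lambda>y. Q - 2 * f y * A + (f y)\<^sup>2)" using if1 if2 by auto
    have "(\<integral>y. Q - 2 * f y * A + (f y)\<^sup>2 \<partial>\<rho>) = 2 * Q - 2 * A\<^sup>2"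
      using if1 if2 by (simp add: prob_space power2_eq_square flip: Q_def A_def)
        (simp add: Q_def A_def power2_eq_square)
    then show ?thesis unfolding inner using nn_integral_eq_integral[OF i] nonneg by simp
  qed
  moreover have "(\<integral>\<^sup>+y. \<integral>\<^sup>+x. ennreal ((f x - f y)\<^sup>2) \<partial>\<rho> \<partial>\<rho>) \<le> ennreal (2 * (M * (K * G)))"
  proof -
    have "(\<integral>\<^sup>+y. \<integral>\<^sup>+x. ennreal ((f x - f y)\<^sup>2) \<partial>\<rho> \<partial>\<rho>)
      \<le> (\<integral>\<^sup>+y. \<integral>\<^sup>+x. (\<Sum>j<M. ennreal (g ((1 - ?s j) *\<^sub>R x + ?s j *\<^sub>R y)))
          + (\<Sum>j<M. ennreal (g ((1 - ?s j) *\<^sub>R y + ?s j *\<^sub>R x))) \<partial>\<rho> \<partial>\<rho>)"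
    proof (rule nn_integral_mono_AE, rule eventually_mono[OF AE_in_X])
      fix y assume "y \<in> X"
      then show "(\<integral>\<^sup>+x. ennreal ((f x - f y)\<^sup>2) \<partial>\<rho>)
        \<le> (\<integral>\<^sup>+x. (\<Sum>j<M. ennreal (g ((1 - ?s j) *\<^sub>R x + ?s j *\<^sub>R y)))
          + (\<Sum>j<M. ennreal (g ((1 - ?s j) *\<^sub>R y + ?s j *\<^sub>R x))) \<partial>\<rho>)"
        by - (rule nn_integral_mono_AE, rule eventually_mono[OF AE_in_X], rule sq)
    qed
    also have "\<dots> = (\<integral>\<^sup>+y. \<integral>\<^sup>+x. (\<Sum>j<M. ennreal (g ((1 - ?s j) *\<^sub>R x + ?s j *\<^sub>R y))) \<partial>\<rho> \<partial>\<rho>)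
        + (\<integral>\<^sup>+y. \<integral>\<^sup>+x. (\<Sum>j<M. ennreal (g ((1 - ?s j) *\<^sub>R y + ?s j *\<^sub>R x))) \<partial>\<rho> \<partial>\<rho>)"
      by (subst nn_integral_add; (subst nn_integral_add)?) auto
    also have "(\<integral>\<^sup>+y. \<integral>\<^sup>+x. (\<Sum>j<M. ennreal (g ((1 - ?s j) *\<^sub>R y + ?s j *\<^sub>R x))) \<partial>\<rho> \<partial>\<rho>)
        = (\<integral>\<^sup>+x. \<integral>\<^sup>+y. (\<Sum>j<M. ennreal (g ((1 - ?s j) *\<^sub>R y + ?s j *\<^sub>R x))) \<partial>\<rho> \<partial>\<rho>)"
      by (rule P.Fubini') measurable
    also have "(\<integral>\<^sup>+y. \<integral>\<^sup>+x. (\<Sum>j<M. ennreal (g ((1 - ?s j) *\<^sub>R x + ?s j *\<^sub>R y))) \<partial>\<rho> \<partial>\<rho>) + \<dots>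
        \<le> ennreal (M * (K * G)) + ennreal (M * (K * G))"
      by (intro add_mono half)
    also have "\<dots> = ennreal (2 * (M * (K * G)))"
      using K G0 by (simp flip: ennreal_plus)
    finally show ?thesis .
  qed
  ultimately have "ennreal (2 * Q - 2 * A\<^sup>2) \<le> ennreal (2 * (M * (K * G)))" by simp
  then have "2 * Q - 2 * A\<^sup>2 \<le> 2 * (M * (K * G))"
    using K G0 by (subst (asm) ennreal_le_iff) auto
  then have "Q - A\<^sup>2 \<le> M * (K * G)" by simp
  then show ?thesis by (simp add: K_def A_def Q_def G_def mult_ac)
qed

end

section \<open>Gaps in a finite set of reals and the variance across a gap\<close>

text \<open>The interval from \<open>v i\<close> to \<open>v j\<close> is divided into \<open>N\<close> left-open intervals of length \<open>d\<close>. None of them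
  contains \<open>v i\<close>, so the remaining \<open>N - 1\<close> values cannot meet all of them.\<close>

lemma exists_gap:
  fixes v :: "'N::finite \<Rightarrow> real"
  assumes ij: "v i < v j" and d: "d = (v j - v i) / CARD('N)"
  obtains a where "v i \<le> a" "a + d \<le> v j" "\<And>k. v k \<le> a \<or> a + d \<le> v k"
proof -
  let ?n = "CARD('N)"
  have d0: "0 < d" using ij by (simp add: d)
  have nd: "?n * d = v j - v i" by (simp add: d)
  have "\<exists>m<?n. \<forall>k. v k \<le> v i + m * d \<or> v i + (m + 1) * d < v k"
  proof (rule ccontr)
    assume "\<not> ?thesis"
    then have "\<forall>m\<in>{..<?n}. \<exists>k. v i + m * d < v k \<and> v k \<le> v i + (m + 1) * d"
      by (meson not_le not_less lessThan_iff)
    then obtain \<kappa> where \<kappa>: "\<And>m. m < ?n \<Longrightarrow> v i + m * d < v (\<kappa> m) \<and> v (\<kappa> m) \<le> v i + (m + 1) * d"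
      by (metis lessThan_iff)
    have neq: "\<kappa> m \<noteq> \<kappa> m'" if "m < m'" "m' < ?n" for m m'
    proof -
      have "(real m + 1) * d \<le> real m' * d" using that d0 by (intro mult_right_mono) auto
      then have "v (\<kappa> m) < v (\<kappa> m')" using \<kappa>[of m] \<kappa>[of m'] that by (simp add: add.commute)
      then show ?thesis by auto
    qed
    have "inj_on \<kappa> {..<?n}"
      by (rule linorder_inj_onI') (use neq in auto)
    then have "card (\<kappa> ` {..<?n}) = ?n" by (simp add: card_image)
    then have "\<kappa> ` {..<?n} = UNIV" by (intro card_subset_eq) auto
    then obtain m where "m < ?n" "\<kappa> m = i" by (metis UNIV_I imageE lessThan_iff)
    then have "v i + m * d < v i" using \<kappa>[of m] by auto
    moreover have "0 \<le> m * d" using d0 by simp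
    ultimately show False by simp
  qed
  then obtain m where m: "m < ?n" "\<And>k. v k \<le> v i + m * d \<or> v i + (m + 1) * d < v k" by blast
  show ?thesis
  proof
    show "v i \<le> v i + m * d" using d0 by simp
    have "(real m + 1) * d \<le> ?n * d" using m(1) d0 by (intro mult_right_mono) auto
    then show "v i + m * d + d \<le> v j" using nd by (simp add: algebra_simps)
    show "v k \<le> v i + m * d \<or> v i + m * d + d \<le> v k" for k
      using m(2)[of k] by (auto simp: algebra_simps)
  qed
qed

text \<open>Since the entries add up to zero, zero lies between the smallest and the largest of them.\<close>

lemma norm_le_card_times_range:
  fixes v :: "real^'N::finite"
  assumes sum0: "(\<Sum>k\<in>UNIV. v $ k) = 0"
  obtains i j where "norm v \<le> CARD('N) * (v $ j - v $ i)"
proof -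
  define i where "i = arg_min_on (\<lambda>k. v $ k) UNIV"
  define j where "j = arg_min_on (\<lambda>k. - v $ k) UNIV"
  have i: "v $ i \<le> v $ k" for k unfolding i_def by (rule arg_min_least) auto
  have j: "v $ k \<le> v $ j" for k using arg_min_least[of UNIV k "\<lambda>k. - v $ k"] by (simp add: j_def)
  have "CARD('N) * (v $ i) \<le> 0"
    using sum_bounded_below[of UNIV "v $ i" "\<lambda>k. v $ k"] i sum0 by simp
  then have i0: "v $ i \<le> 0" by (simp add: mult_le_0_iff)
  have "0 \<le> CARD('N) * (v $ j)"
    using sum_bounded_above[of UNIV "\<lambda>k. v $ k" "v $ j"] j sum0 by simp
  then have j0: "0 \<le> v $ j" by (simp add: zero_le_mult_iff)
  have "norm v \<le> (\<Sum>k\<in>UNIV. \<bar>v $ k\<bar>)" by (rule norm_le_l1_cart)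
  also have "\<dots> \<le> (\<Sum>k\<in>(UNIV::'N set). v $ j - v $ i)"
    using i j i0 j0 by (intro sum_mono) (smt (verit))
  finally show ?thesis by (intro that[of j i]) simp
qed

text \<open>Twice the variance is \<open>\<Sum>k l. p k * p l * (v k - v l)\<^sup>2\<close>, and the pairs separated by \<open>S\<close> have total
  weight twice \<open>P (1 - P)\<close>, where \<open>P\<close> is the weight of \<open>S\<close>.\<close>

lemma variance_ge_of_gap:
  fixes p v :: "'N::finite \<Rightarrow> real"
  assumes p0: "\<And>k. 0 \<le> p k" and p1: "(\<Sum>k\<in>UNIV. p k) = 1"
    and d: "0 \<le> d" and gap: "\<And>k l. k \<in> S \<Longrightarrow> l \<notin> S \<Longrightarrow> d \<le> \<bar>v k - v l\<bar>"
  shows "d\<^sup>2 * ((\<Sum>k\<in>S. p k) * (1 - (\<Sum>k\<in>S. p k))) \<le> (\<Sum>k\<in>UNIV. p k * (v k)\<^sup>2) - (\<Sum>k\<in>UNIV. p k * v k)\<^sup>2"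
proof -
  define s where "s k = (of_bool (k \<in> S) :: real)" for k
  define P where "P = (\<Sum>k\<in>S. p k)"
  have P: "(\<Sum>k\<in>UNIV. p k * s k) = P"
    by (simp add: s_def P_def of_bool_def if_distrib sum.If_cases cong: if_cong)
  have "(\<Sum>k\<in>UNIV. \<Sum>l\<in>UNIV. p k * p l * (s k + s l - 2 * (s k * s l)))
      = (\<Sum>k\<in>UNIV. p k * s k) * (\<Sum>l\<in>UNIV. p l) + (\<Sum>k\<in>UNIV. p k) * (\<Sum>l\<in>UNIV. p l * s l)
        - 2 * ((\<Sum>k\<in>UNIV. p k * s k) * (\<Sum>l\<in>UNIV. p l * s l))"
    (is "?lhs = _")
  proof -
    have "?lhs = (\<Sum>k\<in>UNIV. \<Sum>l\<in>UNIV. (p k * s k) * p l + p k * (p l * s l) - 2 * ((p k * s k) * (p l * s l)))"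
      by (simp add: algebra_simps)
    then show ?thesis
      by (simp only: sum.distrib sum_subtractf sum_product) (simp only: sum_distrib_left)
  qed
  then have cut: "(\<Sum>k\<in>UNIV. \<Sum>l\<in>UNIV. p k * p l * (s k + s l - 2 * (s k * s l))) = 2 * (P * (1 - P))"
    by (simp add: P p1 algebra_simps)
  have "(\<Sum>k\<in>UNIV. \<Sum>l\<in>UNIV. p k * p l * (v k - v l)\<^sup>2)
      = (\<Sum>k\<in>UNIV. p k * (v k)\<^sup>2) * (\<Sum>l\<in>UNIV. p l) + (\<Sum>k\<in>UNIV. p k) * (\<Sum>l\<in>UNIV. p l * (v l)\<^sup>2)
        - 2 * ((\<Sum>k\<in>UNIV. p k * v k) * (\<Sum>l\<in>UNIV. p l * v l))"
    (is "?lhs = _")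
  proof -
    have "?lhs = (\<Sum>k\<in>UNIV. \<Sum>l\<in>UNIV. (p k * (v k)\<^sup>2) * p l + p k * (p l * (v l)\<^sup>2) - 2 * ((p k * v k) * (p l * v l)))"
      by (simp add: power2_eq_square algebra_simps)
    then show ?thesis
      by (simp only: sum.distrib sum_subtractf sum_product) (simp only: sum_distrib_left)
  qed
  then have var: "(\<Sum>k\<in>UNIV. \<Sum>l\<in>UNIV. p k * p l * (v k - v l)\<^sup>2)
      = 2 * ((\<Sum>k\<in>UNIV. p k * (v k)\<^sup>2) - (\<Sum>k\<in>UNIV. p k * v k)\<^sup>2)"
    by (simp add: p1 power2_eq_square algebra_simps)
  have "d\<^sup>2 * (\<Sum>k\<in>UNIV. \<Sum>l\<in>UNIV. p k * p l * (s k + s l - 2 * (s k * s l)))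
      \<le> (\<Sum>k\<in>UNIV. \<Sum>l\<in>UNIV. p k * p l * (v k - v l)\<^sup>2)"
    unfolding sum_distrib_left
  proof (intro sum_mono)
    fix k l
    have "d\<^sup>2 * (s k + s l - 2 * (s k * s l)) \<le> (v k - v l)\<^sup>2"
    proof (cases "k \<in> S \<longleftrightarrow> l \<in> S")
      case True
      then show ?thesis by (auto simp: s_def)
    next
      case False
      then have "d \<le> \<bar>v k - v l\<bar>" using gap[of k l] gap[of l k] by (auto simp: abs_minus_commute)
      then have "d\<^sup>2 \<le> (v k - v l)\<^sup>2" using d power_mono[of d "\<bar>v k - v l\<bar>" 2] by simp
      then show ?thesis using False by (auto simp: s_def)
    qed
    then have "(p k * p l) * (d\<^sup>2 * (s k + s l - 2 * (s k * s l))) \<le> (p k * p l) * (v k - v l)\<^sup>2"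
      using p0 by (intro mult_left_mono) auto
    then show "d\<^sup>2 * (p k * p l * (s k + s l - 2 * (s k * s l))) \<le> p k * p l * (v k - v l)\<^sup>2"
      by (simp only: mult_ac)
  qed
  then show ?thesis unfolding cut var P_def by simp
qed

section \<open>The cut inequality for Gibbs weights\<close>

text \<open>Component \<open>k\<close> of \<open>a x\<close> stands for the cost \<open>c x (y k)\<close>. Measurability and the bound are
  asked for on the whole space so that integrals need no restriction to \<open>X\<close>; a cost given only on \<open>X\<close> is extended by zero.\<close>

locale smoothed_transport = density_on_convex \<rho> X r m_lo m_hi
  for \<rho> :: "'a::euclidean_space measure" and X r m_lo m_hi +
  fixes a :: "'a \<Rightarrow> real^'N::finite" and B L D :: real
  assumes a_borel[measurable]: "a \<in> borel_measurable borel"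
    and a_bound: "\<And>x k. \<bar>a x $ k\<bar> \<le> B"
    and a_Lipschitz: "\<And>x z k. x \<in> X \<Longrightarrow> z \<in> X \<Longrightarrow> \<bar>a z $ k - a x $ k\<bar> \<le> L * norm (z - x)"
    and L_pos: "0 < L"
    and X_diam: "\<And>x z. x \<in> X \<Longrightarrow> z \<in> X \<Longrightarrow> norm (z - x) \<le> D"
    and D_nonneg: "0 \<le> D"
begin

definition gibbs :: "real \<Rightarrow> real^'N \<Rightarrow> 'a \<Rightarrow> real^'N" where
  "gibbs t \<phi> x = softmax ((1 / (1 - t)) *\<^sub>R \<phi> - (t / (1 - t)) *\<^sub>R a x)"

lemma a_nth_borel[measurable]: "(\<lambda>x. a x $ k) \<in> borel_measurable borel"
  by (rule borel_measurable_continuous_on[OF _ a_borel]) (intro continuous_intros)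

lemma gibbs_borel[measurable]: "gibbs t \<phi> \<in> borel_measurable borel"
  unfolding gibbs_def by (rule borel_measurable_continuous_on[OF continuous_softmax]) simp

lemma gibbs_nth_borel[measurable]: "(\<lambda>x. gibbs t \<phi> x $ k) \<in> borel_measurable borel"
  by (rule borel_measurable_continuous_on[OF _ gibbs_borel]) (intro continuous_intros)

lemma gibbs_pos: "0 < gibbs t \<phi> x $ k" and gibbs_le_1: "gibbs t \<phi> x $ k \<le> 1"
  and sum_gibbs: "(\<Sum>k\<in>UNIV. gibbs t \<phi> x $ k) = 1"
  by (simp_all add: gibbs_def softmax_pos softmax_le_1 sum_softmax)

lemma integrable_gibbs_nth[simp]: "integrable \<rho> (\<lambda>x. gibbs t \<phi> x $ k)"
  by (rule integrable_const_bound[where B=1])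
    (use gibbs_pos gibbs_le_1 in \<open>auto simp: abs_of_pos\<close>)

definition cut_constant :: real where
  "cut_constant = 1 + exp 1 * (2 ^ DIM('a) * m_hi / m_lo) * (D * L + 2)"

lemma cut_constant_pos: "0 < cut_constant"
proof -
  have "0 \<le> exp 1 * (2 ^ DIM('a) * m_hi / m_lo) * (D * L + 2)"
    using hi_pos lo_pos D_nonneg L_pos by simp
  then show ?thesis by (simp add: cut_constant_def)
qed

text \<open>On steps of length \<open>\<epsilon> / (2 * L)\<close> with \<open>\<epsilon> = 1 - t\<close>, the exponents change by at most one half, so \<open>f\<close> changes
  by at most \<open>exp 1 * f (1 - f)\<close>. Half of a segment in \<open>X\<close> takes about \<open>D * L / \<epsilon>\<close> such steps, which is where the
  factor \<open>1 / (1 - t)\<close> on the right-hand side comes from. The term \<open>D * L + 2\<close> of \<open>cut_constant\<close> bounds \<open>\<epsilon>\<close> times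
  the number of steps, and so the constant does not depend on \<open>t\<close>.\<close>

lemma cut_inequality:
  fixes S :: "'N set" and \<phi> :: "real^'N"
  assumes t: "0 \<le> t" "t < 1"
  defines "f \<equiv> \<lambda>x. \<Sum>k\<in>S. gibbs t \<phi> x $ k"
  shows "(\<integral>x. f x \<partial>\<rho>) * (1 - (\<integral>x. f x \<partial>\<rho>)) \<le> cut_constant * ((1 / (1 - t)) * (\<integral>x. f x * (1 - f x) \<partial>\<rho>))"
proof -
  define \<epsilon> where "\<epsilon> = 1 - t"
  have \<epsilon>: "0 < \<epsilon>" "\<epsilon> \<le> 1" using t by (auto simp: \<epsilon>_def)
  define K where "K = 2 ^ DIM('a) * m_hi / m_lo"
  have K: "0 < K" using hi_pos lo_pos by (simp add: K_def)
  \<comment> \<open>the added one makes \<open>M\<close> positive even if \<open>D\<close> is zero\<close>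
  define M where "M = nat \<lceil>D * L / \<epsilon>\<rceil> + 1"
  have DL: "0 \<le> D * L / \<epsilon>" using D_nonneg L_pos \<epsilon> by simp
  have M_ge: "D * L / \<epsilon> \<le> M" and M_le: "M \<le> D * L / \<epsilon> + 2" unfolding M_def using DL by linarith+
  have fb[measurable]: "f \<in> borel_measurable borel" unfolding f_def by measurable
  have f0: "0 \<le> f x" for x unfolding f_def by (intro sum_nonneg less_imp_le[OF gibbs_pos])
  have f1: "f x \<le> 1" for x
    unfolding f_def sum_gibbs[of t \<phi> x, symmetric] by (intro sum_mono2 less_imp_le[OF gibbs_pos]) auto
  have ff: "f x * (1 - f x) \<le> 1" for x using f0[of x] f1[of x] by (simp add: mult_le_one)
  have if1: "integrable \<rho> f" unfolding f_def by simp
  have if2: "integrable \<rho> (\<lambda>x. f x * (1 - f x))"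
    by (rule integrable_const_bound[where B=1]) (use f0 f1 ff in auto)
  define A where "A = (\<integral>x. f x \<partial>\<rho>)"
  define C where "C = (\<integral>x. f x * (1 - f x) \<partial>\<rho>)"
  have C0: "0 \<le> C" unfolding C_def using f0 f1 by simp
  have "(\<integral>x. (f x)\<^sup>2 \<partial>\<rho>) - (\<integral>x. f x \<partial>\<rho>)\<^sup>2 \<le> 2 ^ DIM('a) * m_hi / m_lo * M * (\<integral>x. exp 1 * (f x * (1 - f x)) \<partial>\<rho>)"
  proof (rule variance_le_of_short_steps[where B="exp 1" and h="\<epsilon> / (2 * L)"])
    show "exp 1 * (f x * (1 - f x)) \<le> exp 1" for x using ff[of x] by simp
    show "0 < M" by (simp add: M_def)
    show "norm (z - x) \<le> 2 * real M * (\<epsilon> / (2 * L))" if "x \<in> X" "z \<in> X" for x z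
    proof -
      have "L * norm (z - x) \<le> L * D" using X_diam[OF that] L_pos by (intro mult_left_mono) auto
      also have "\<dots> \<le> \<epsilon> * M" using M_ge \<epsilon> by (simp add: field_simps)
      finally show ?thesis using L_pos by (simp add: field_simps)
    qed
    show "\<bar>f z - f x\<bar> \<le> exp 1 * (f x * (1 - f x))"
      if xz: "x \<in> X" "z \<in> X" "norm (z - x) \<le> \<epsilon> / (2 * L)" for x z
    proof -
      let ?u = "\<lambda>x. (1 / (1 - t)) *\<^sub>R \<phi> - (t / (1 - t)) *\<^sub>R a x"
      have "\<bar>?u z $ k - ?u x $ k\<bar> \<le> 1 / 2" for k
      proof -
        have "?u z $ k - ?u x $ k = - ((t / \<epsilon>) * (a z $ k - a x $ k))"
          by (simp add: \<epsilon>_def right_diff_distrib)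
        then have "\<bar>?u z $ k - ?u x $ k\<bar> = (t / \<epsilon>) * \<bar>a z $ k - a x $ k\<bar>"
          using t \<epsilon> by (simp add: abs_mult)
        also have "\<dots> \<le> (1 / \<epsilon>) * (L * (\<epsilon> / (2 * L)))"
          using t \<epsilon> L_pos xz by (intro mult_mono divide_right_mono order_trans[OF a_Lipschitz] mult_left_mono) auto
        also have "\<dots> = 1 / 2" using \<epsilon> L_pos by simp
        finally show ?thesis .
      qed
      from softmax_cut_diff_le[OF this, of S] show ?thesis by (simp add: f_def gibbs_def)
    qed
  qed (use f0 f1 in auto)
  moreover have "(\<integral>x. (f x)\<^sup>2 \<partial>\<rho>) = A - C"
  proof -
    have "(\<integral>x. (f x)\<^sup>2 \<partial>\<rho>) = (\<integral>x. f x - f x * (1 - f x) \<partial>\<rho>)"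
      by (intro Bochner_Integration.integral_cong) (auto simp: power2_eq_square algebra_simps)
    then show ?thesis using if1 if2 by (simp add: A_def C_def)
  qed
  ultimately have "A - C - A\<^sup>2 \<le> K * M * (exp 1 * C)" by (simp add: A_def C_def K_def)
  then have "A * (1 - A) \<le> C * (1 + exp 1 * K * M)" by (simp add: power2_eq_square algebra_simps)
  also have "\<dots> \<le> C * (cut_constant / \<epsilon>)"
  proof (rule mult_left_mono[OF _ C0])
    have "\<epsilon> * M \<le> D * L + 2"
    proof -
      have "\<epsilon> * M \<le> \<epsilon> * (D * L / \<epsilon> + 2)" by (rule mult_left_mono[OF M_le]) (use \<epsilon> in simp)
      also have "\<dots> = D * L + 2 * \<epsilon>" using \<epsilon> by (simp add: field_simps)
      finally show ?thesis using \<epsilon> by simp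
    qed
    then have "exp 1 * K * (\<epsilon> * M) \<le> exp 1 * K * (D * L + 2)" using K by (intro mult_left_mono) auto
    then have "\<epsilon> * (1 + exp 1 * K * M) \<le> cut_constant"
      unfolding cut_constant_def K_def[symmetric] using \<epsilon>(2) by (simp add: algebra_simps)
    then show "1 + exp 1 * K * M \<le> cut_constant / \<epsilon>" using \<epsilon> by (simp add: le_divide_eq mult.commute)
  qed
  finally show ?thesis by (simp add: A_def C_def \<epsilon>_def mult.commute)
qed

section \<open>Uniform lower bound for the mass of the Gibbs weights\<close>

text \<open>A point of \<open>X\<close> outside the strict cell of \<open>k\<close> lies in the closed cell of another index, even when the minimum is
  attained at \<open>k\<close>, for then it is attained twice. So the strict cell has mass at least one minus the masses of
  the other closed cells.\<close>

lemma strict_cell_mass: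
  fixes \<psi> :: "real^'N"
  assumes total: "(\<Sum>k\<in>UNIV. \<mu> k) = 1"
    and cells: "\<And>k. \<mu> k = measure \<rho> {x\<in>X. \<forall>l. l \<noteq> k \<longrightarrow> a x $ k - \<psi> $ k \<le> a x $ l - \<psi> $ l}"
  shows "\<mu> k \<le> measure \<rho> {x\<in>X. \<forall>l. l \<noteq> k \<longrightarrow> a x $ k - \<psi> $ k < a x $ l - \<psi> $ l}"
proof -
  define V where "V l = {x\<in>X. \<forall>j. j \<noteq> l \<longrightarrow> a x $ l - \<psi> $ l \<le> a x $ j - \<psi> $ j}" for l
  let ?R = "{x\<in>X. \<forall>l. l \<noteq> k \<longrightarrow> a x $ k - \<psi> $ k < a x $ l - \<psi> $ l}"
  have V_sets: "V l \<in> sets \<rho>" for l unfolding sets_rho V_def by measurable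
  have R_sets: "?R \<in> sets \<rho>" unfolding sets_rho by measurable
  have cover: "X \<subseteq> ?R \<union> (\<Union>l\<in>UNIV - {k}. V l)"
  proof
    fix x assume x: "x \<in> X"
    let ?w = "\<lambda>l. a x $ l - \<psi> $ l"
    define m where "m = arg_min_on ?w UNIV"
    have m: "?w m \<le> ?w l" for l unfolding m_def by (rule arg_min_least) auto
    show "x \<in> ?R \<union> (\<Union>l\<in>UNIV - {k}. V l)"
    proof (cases "x \<in> ?R")
      case False
      then obtain l where l: "l \<noteq> k" "?w l \<le> ?w k" using x by (auto simp: not_less)
      define m' where "m' = (if m = k then l else m)"
      have "?w m' \<le> ?w j" for j using m[of j] l(2) by (auto simp: m'_def intro: order_trans)
      moreover have "m' \<noteq> k" using l(1) by (simp add: m'_def)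
      ultimately show ?thesis using x by (auto simp: V_def)
    qed simp
  qed
  have "1 = measure \<rho> X"
    using AE_in_X prob_eq_1[of X] by (simp add: sets_rho)
  also have "\<dots> \<le> measure \<rho> (?R \<union> (\<Union>l\<in>UNIV - {k}. V l))"
    by (rule finite_measure_mono[OF cover]) (use V_sets R_sets in auto)
  also have "\<dots> \<le> measure \<rho> ?R + measure \<rho> (\<Union>l\<in>UNIV - {k}. V l)"
    by (rule measure_Un_le) (use V_sets R_sets in auto)
  also have "measure \<rho> (\<Union>l\<in>UNIV - {k}. V l) \<le> (\<Sum>l\<in>UNIV - {k}. measure \<rho> (V l))"
    by (rule finite_measure_subadditive_finite) (use V_sets in auto)
  also have "\<dots> = (\<Sum>l\<in>UNIV - {k}. \<mu> l)" by (simp add: cells V_def)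
  also have "\<dots> = 1 - \<mu> k" using total by (simp add: sum_diff1)
  finally show ?thesis by simp
qed

text \<open>The strict cell is the increasing union of the sets \<open>U k m\<close> where the inequalities hold with margin
  \<open>1 / (m + 1)\<close>, so some \<open>m\<close> gives positive mass for all \<open>k\<close> at once. On \<open>U k m\<close>, for \<open>\<phi>\<close> within half the margin of
  \<open>\<psi>0\<close>, the exponents satisfy \<open>u l - u k = ((\<phi> l - a l) - (\<phi> k - a k)) / (1 - t) + (a l - a k)\<close>. The first summand is
  at most zero, however small \<open>1 - t\<close> is, and the second at most \<open>2 * B\<close>.\<close>

lemma gibbs_mass_lower_bound:
  fixes \<psi>0 :: "real^'N"
  assumes mass: "\<And>k. \<mu> k \<le> measure \<rho> {x\<in>X. \<forall>l. l \<noteq> k \<longrightarrow> a x $ k - \<psi>0 $ k < a x $ l - \<psi>0 $ l}"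
    and \<mu>: "\<And>k. 0 < \<mu> k"
  obtains \<alpha> \<eta> where "0 < \<alpha>" "0 < \<eta>"
    "\<And>t \<phi> k. 0 \<le> t \<Longrightarrow> t < 1 \<Longrightarrow> (\<And>l. \<bar>\<phi> $ l - \<psi>0 $ l\<bar> \<le> \<eta>) \<Longrightarrow> \<alpha> \<le> (\<integral>x. gibbs t \<phi> x $ k \<partial>\<rho>)"
proof -
  define U where "U k m = {x\<in>X. \<forall>l. l \<noteq> k \<longrightarrow> a x $ k - \<psi>0 $ k + 1 / real (Suc m) \<le> a x $ l - \<psi>0 $ l}" for k m
  have U_sets[measurable]: "U k m \<in> sets \<rho>" for k m unfolding sets_rho U_def by measurable
  have "incseq (U k)" for k
  proof (rule incseq_SucI, rule subsetI)
    fix m x assume x: "x \<in> U k m"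
    have "1 / real (Suc (Suc m)) \<le> 1 / real (Suc m)" by (simp add: field_simps)
    then show "x \<in> U k (Suc m)" using x unfolding U_def by fastforce
  qed
  then have lim: "(\<lambda>m. measure \<rho> (U k m)) \<longlonglongrightarrow> measure \<rho> (\<Union>m. U k m)" for k
    by (intro finite_Lim_measure_incseq) (use U_sets in auto)
  have Un: "(\<Union>m. U k m) = {x\<in>X. \<forall>l. l \<noteq> k \<longrightarrow> a x $ k - \<psi>0 $ k < a x $ l - \<psi>0 $ l}" (is "_ = ?R") for k
  proof (intro set_eqI iffI)
    fix x assume "x \<in> (\<Union>m. U k m)"
    then obtain m where m: "x \<in> U k m" by blast
    have pos: "0 < 1 / real (Suc m)" by simp
    have "a x $ k - \<psi>0 $ k < a x $ l - \<psi>0 $ l" if "l \<noteq> k" for l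
    proof -
      have "a x $ k - \<psi>0 $ k + 1 / real (Suc m) \<le> a x $ l - \<psi>0 $ l"
        using m that unfolding U_def by blast
      then show ?thesis using pos by linarith
    qed
    then show "x \<in> ?R" using m by (simp add: U_def)
  next
    fix x assume x: "x \<in> ?R"
    have "\<forall>\<^sub>F m in sequentially. \<forall>l\<in>UNIV - {k}. 1 / real (Suc m) < (a x $ l - \<psi>0 $ l) - (a x $ k - \<psi>0 $ k)"
      using x by (intro eventually_ball_finite ballI order_tendstoD(2)[OF LIMSEQ_Suc[OF lim_1_over_n]]) auto
    then obtain m where "\<forall>l\<in>UNIV - {k}. 1 / real (Suc m) < (a x $ l - \<psi>0 $ l) - (a x $ k - \<psi>0 $ k)"
      by (auto simp: eventually_sequentially)
    then have "a x $ k - \<psi>0 $ k + 1 / real (Suc m) \<le> a x $ l - \<psi>0 $ l" if "l \<noteq> k" for l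
      using that by (smt (verit) DiffI UNIV_I singletonD)
    then have "x \<in> U k m" using x by (simp add: U_def)
    then show "x \<in> (\<Union>m. U k m)" by blast
  qed
  have "\<forall>\<^sub>F m in sequentially. \<forall>k\<in>UNIV. 0 < measure \<rho> (U k m)"
  proof (intro eventually_ball_finite ballI)
    show "\<forall>\<^sub>F m in sequentially. 0 < measure \<rho> (U k m)" for k
      by (rule order_tendstoD(1)[OF lim]) (use Un mass[of k] \<mu>[of k] in simp)
  qed simp
  then obtain m where m: "\<And>k. 0 < measure \<rho> (U k m)" by (auto simp: eventually_sequentially)
  define \<eta> where "\<eta> = 1 / real (2 * Suc m)"
  define \<beta> where "\<beta> = 1 / (CARD('N) * exp (2 * B))"
  have \<beta>: "0 < \<beta>" by (simp add: \<beta>_def)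
  define \<alpha> where "\<alpha> = \<beta> * Min (range (\<lambda>k. measure \<rho> (U k m)))"
  show ?thesis
  proof
    have "0 < Min (range (\<lambda>k. measure \<rho> (U k m)))" using m by (subst Min_gr_iff) auto
    then show "0 < \<alpha>" using \<beta> by (simp add: \<alpha>_def)
    show "0 < \<eta>" by (simp add: \<eta>_def)
    fix t :: real and \<phi> :: "real^'N" and k :: 'N
    assume t: "0 \<le> t" "t < 1" and \<phi>: "\<And>l. \<bar>\<phi> $ l - \<psi>0 $ l\<bar> \<le> \<eta>"
    have on_U: "\<beta> \<le> gibbs t \<phi> x $ k" if x: "x \<in> U k m" for x
    proof -
      define u where "u = (1 / (1 - t)) *\<^sub>R \<phi> - (t / (1 - t)) *\<^sub>R a x"
      have "u $ l \<le> 2 * B + u $ k" for l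
      proof -
        have "(\<phi> $ l - a x $ l) - (\<phi> $ k - a x $ k) \<le> 0"
        proof (cases "l = k")
          case False
          then have "a x $ k - \<psi>0 $ k + 1 / real (Suc m) \<le> a x $ l - \<psi>0 $ l" using x by (simp add: U_def)
          moreover have "1 / real (Suc m) = 2 * \<eta>" by (simp add: \<eta>_def field_simps)
          ultimately show ?thesis using \<phi>[of l] \<phi>[of k] by (simp only: abs_le_iff) linarith
        qed simp
        moreover have "a x $ l - a x $ k \<le> 2 * B" using a_bound[of x l] a_bound[of x k] by linarith
        then have "(1 - t) * (a x $ l - a x $ k) \<le> (1 - t) * (2 * B)" using t by (intro mult_left_mono) auto
        ultimately have "(\<phi> $ l - t * a x $ l) - (\<phi> $ k - t * a x $ k) \<le> (1 - t) * (2 * B)"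
          by (simp add: algebra_simps)
        then have "((\<phi> $ l - t * a x $ l) - (\<phi> $ k - t * a x $ k)) / (1 - t) \<le> 2 * B"
          using t by (simp add: divide_le_eq mult.commute)
        moreover have "u $ l - u $ k = ((\<phi> $ l - t * a x $ l) - (\<phi> $ k - t * a x $ k)) / (1 - t)"
          by (simp add: u_def diff_divide_distrib)
        ultimately show ?thesis by simp
      qed
      then have "exp (u $ l) \<le> exp (2 * B) * exp (u $ k)" for l by (simp flip: exp_add)
      then have "(\<Sum>l\<in>(UNIV::'N set). exp (u $ l)) \<le> CARD('N) * (exp (2 * B) * exp (u $ k))"
        using sum_bounded_above[of UNIV "\<lambda>l. exp (u $ l)"] by simp
      then show ?thesis using sum_exp_pos[of u]
        by (simp add: gibbs_def softmax_def \<beta>_def field_simps flip: u_def)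
    qed
    have "Min (range (\<lambda>k. measure \<rho> (U k m))) \<le> measure \<rho> (U k m)" by (intro Min_le) auto
    then have "\<alpha> \<le> \<beta> * measure \<rho> (U k m)" unfolding \<alpha>_def using \<beta> by (intro mult_left_mono) auto
    also have "\<dots> = (\<integral>x. \<beta> * indicator (U k m) x \<partial>\<rho>)" using space_rho by simp
    also have "\<dots> \<le> (\<integral>x. gibbs t \<phi> x $ k \<partial>\<rho>)"
    proof (rule integral_mono)
      show "integrable \<rho> (\<lambda>x. \<beta> * indicator (U k m) x)"
        by (intro integrable_mult_right integrable_real_indicator) (auto simp: emeasure_eq_measure)
      show "\<beta> * indicator (U k m) x \<le> gibbs t \<phi> x $ k" for x
        using on_U[of x] gibbs_pos[of t \<phi> x k] by (cases "x \<in> U k m") auto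
    qed simp
    finally show "\<alpha> \<le> (\<integral>x. gibbs t \<phi> x $ k \<partial>\<rho>)" .
  qed
qed

section \<open>The Hessian and its coercivity\<close>

text \<open>Row \<open>k\<close> is the gradient of the Gibbs mass \<open>\<integral>x. gibbs t \<phi> x $ k \<partial>\<rho>\<close> as a function of \<open>\<phi>\<close>.\<close>

definition hess :: "real \<Rightarrow> real^'N \<Rightarrow> real^'N^'N" where
  "hess t \<phi> = (\<chi> k. (1 / (1 - t)) *\<^sub>R (\<integral>x. (gibbs t \<phi> x $ k) *\<^sub>R (axis k 1 - gibbs t \<phi> x) \<partial>\<rho>))"

lemma integrable_gibbs_field: "integrable \<rho> (\<lambda>x. (gibbs t \<phi> x $ k) *\<^sub>R (axis k 1 - gibbs t \<phi> x))"
  by (rule integrable_const_bound[where B=2])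
    (use norm_grad_softmax_le in \<open>auto simp: gibbs_def[symmetric] simp del: norm_scaleR\<close>,
      auto simp: gibbs_def simp del: norm_scaleR intro!: norm_grad_softmax_le)

lemma hess_quadratic_form:
  "v \<bullet> (hess t \<phi> *v v) = (1 / (1 - t)) *
    (\<integral>x. (\<Sum>k\<in>UNIV. gibbs t \<phi> x $ k * (v $ k)\<^sup>2) - (\<Sum>k\<in>UNIV. gibbs t \<phi> x $ k * v $ k)\<^sup>2 \<partial>\<rho>)"
proof -
  let ?p = "gibbs t \<phi>"
  have row: "(hess t \<phi> *v v) $ k = (1 / (1 - t)) * (\<integral>x. ?p x $ k * (v $ k - ?p x \<bullet> v) \<partial>\<rho>)" for k
  proof -
    have "(hess t \<phi> *v v) $ k = (hess t \<phi> $ k) \<bullet> v" by (simp add: matrix_vector_mult_def inner_vec_def)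
    also have "\<dots> = (1 / (1 - t)) * ((\<integral>x. (?p x $ k) *\<^sub>R (axis k 1 - ?p x) \<partial>\<rho>) \<bullet> v)"
      by (simp add: hess_def)
    also have "(\<integral>x. (?p x $ k) *\<^sub>R (axis k 1 - ?p x) \<partial>\<rho>) \<bullet> v = (\<integral>x. ((?p x $ k) *\<^sub>R (axis k 1 - ?p x)) \<bullet> v \<partial>\<rho>)"
      by (rule integral_inner_left[symmetric]) (rule integrable_gibbs_field)
    also have "\<dots> = (\<integral>x. ?p x $ k * (v $ k - ?p x \<bullet> v) \<partial>\<rho>)"
      by (simp add: inner_diff_left inner_axis')
    finally show ?thesis .
  qed
  have int: "integrable \<rho> (\<lambda>x. ?p x $ k * (v $ k - ?p x \<bullet> v))" for k
  proof -
    have "integrable \<rho> (\<lambda>x. ((?p x $ k) *\<^sub>R (axis k 1 - ?p x)) \<bullet> v)"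
      by (intro integrable_inner_left integrable_gibbs_field)
    then show ?thesis by (simp add: inner_diff_left inner_axis')
  qed
  have "v \<bullet> (hess t \<phi> *v v) = (\<Sum>k\<in>UNIV. v $ k * ((1 / (1 - t)) * (\<integral>x. ?p x $ k * (v $ k - ?p x \<bullet> v) \<partial>\<rho>)))"
    by (simp add: inner_vec_def[of v "hess t \<phi> *v v"] row)
  also have "\<dots> = (1 / (1 - t)) * (\<integral>x. (\<Sum>k\<in>UNIV. v $ k * (?p x $ k * (v $ k - ?p x \<bullet> v))) \<partial>\<rho>)"
    using int by (simp add: sum_distrib_left mult_ac)
  finally have eq: "v \<bullet> (hess t \<phi> *v v)
      = (1 / (1 - t)) * (\<integral>x. (\<Sum>k\<in>UNIV. v $ k * (?p x $ k * (v $ k - ?p x \<bullet> v))) \<partial>\<rho>)" .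
  have "(\<Sum>k\<in>UNIV. v $ k * (?p x $ k * (v $ k - ?p x \<bullet> v)))
      = (\<Sum>k\<in>UNIV. ?p x $ k * (v $ k)\<^sup>2) - (\<Sum>k\<in>UNIV. ?p x $ k * v $ k)\<^sup>2" for x
  proof -
    have "(\<Sum>k\<in>UNIV. v $ k * (?p x $ k * (v $ k - ?p x \<bullet> v)))
        = (\<Sum>k\<in>UNIV. ?p x $ k * (v $ k)\<^sup>2) - (\<Sum>k\<in>UNIV. ?p x $ k * v $ k) * (?p x \<bullet> v)"
      unfolding sum_distrib_right sum_subtractf[symmetric]
      by (intro sum.cong) (auto simp: power2_eq_square algebra_simps)
    then show ?thesis by (simp add: inner_vec_def power2_eq_square)
  qed
  then show ?thesis unfolding eq by simp
qed

text \<open>The gap separates \<open>i\<close> and \<open>j\<close>, so the mean of \<open>f\<close> is at least that of the weight of \<open>i\<close>, and the mean of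
  \<open>1 - f\<close> at least that of the weight of \<open>j\<close>. The cut inequality and the variance bound across the gap, whose
  length is at least \<open>norm v / N\<^sup>2\<close>, then give the constant.\<close>

lemma hess_coercive:
  assumes t: "0 \<le> t" "t < 1" and \<alpha>: "0 < \<alpha>" "\<And>k. \<alpha> \<le> (\<integral>x. gibbs t \<phi> x $ k \<partial>\<rho>)"
    and v: "(\<Sum>k\<in>UNIV. v $ k) = 0"
  shows "\<alpha>\<^sup>2 / (cut_constant * CARD('N) ^ 4) * (norm v)\<^sup>2 \<le> v \<bullet> (hess t \<phi> *v v)"
proof (cases "v = 0")
  case False
  let ?n = "real CARD('N)" and ?p = "gibbs t \<phi>"
  obtain i j where nv: "norm v \<le> ?n * (v $ j - v $ i)" using norm_le_card_times_range[OF v] by metis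
  then have "0 < ?n * (v $ j - v $ i)" using False by (smt (verit) zero_less_norm_iff)
  then have ij: "v $ i < v $ j" by (simp add: zero_less_mult_iff)
  define d where "d = (v $ j - v $ i) / ?n"
  obtain b where b: "v $ i \<le> b" "b + d \<le> v $ j" "\<And>k. v $ k \<le> b \<or> b + d \<le> v $ k"
    using exists_gap[of "($) v", OF ij d_def] by blast
  have d: "0 < d" using ij by (simp add: d_def)
  have nd: "norm v \<le> ?n\<^sup>2 * d" using nv by (simp add: d_def power2_eq_square)
  define S where "S = {k. v $ k \<le> b}"
  have iS: "i \<in> S" and jS: "j \<notin> S" using b d by (auto simp: S_def)
  define f where "f x = (\<Sum>k\<in>S. ?p x $ k)" for x
  define A where "A = (\<integral>x. f x \<partial>\<rho>)"
  have if1: "integrable \<rho> f" unfolding f_def by simp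
  have "\<alpha> \<le> A"
  proof -
    have "(\<integral>x. ?p x $ i \<partial>\<rho>) \<le> A"
      unfolding A_def f_def
      by (rule integral_mono) (use iS in \<open>auto intro!: member_le_sum less_imp_le[OF gibbs_pos]\<close>)
    then show ?thesis using \<alpha>(2)[of i] by simp
  qed
  moreover have "\<alpha> \<le> 1 - A"
  proof -
    have "?p x $ j \<le> 1 - f x" for x
    proof -
      have "1 - f x = (\<Sum>k\<in>-S. ?p x $ k)"
        using sum.subset_diff[of S UNIV "\<lambda>k. ?p x $ k"] by (simp add: f_def sum_gibbs Compl_eq_Diff_UNIV)
      then show ?thesis using jS by (auto intro!: member_le_sum less_imp_le[OF gibbs_pos])
    qed
    then have "(\<integral>x. ?p x $ j \<partial>\<rho>) \<le> (\<integral>x. 1 - f x \<partial>\<rho>)" using if1 by (intro integral_mono) auto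
    also have "\<dots> = 1 - A" using if1 by (simp add: A_def prob_space)
    finally show ?thesis using \<alpha>(2)[of j] by simp
  qed
  ultimately have "\<alpha> * \<alpha> \<le> A * (1 - A)" using \<alpha>(1) by (intro mult_mono) auto
  also have "\<dots> \<le> cut_constant * ((1 / (1 - t)) * (\<integral>x. f x * (1 - f x) \<partial>\<rho>))"
    using cut_inequality[OF t, where S=S and \<phi>=\<phi>] by (simp add: A_def f_def)
  finally have cut: "\<alpha>\<^sup>2 / cut_constant \<le> (1 / (1 - t)) * (\<integral>x. f x * (1 - f x) \<partial>\<rho>)"
    using cut_constant_pos by (simp add: divide_le_eq power2_eq_square mult.commute)
  have gap: "d \<le> \<bar>v $ k - v $ l\<bar>" if "k \<in> S" "l \<notin> S" for k l
    using that b(3)[of l] by (auto simp: S_def)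
  have fb: "f \<in> borel_measurable \<rho>" using if1 by simp
  have f01: "0 \<le> f x" "f x \<le> 1" for x
  proof -
    show "0 \<le> f x" unfolding f_def by (intro sum_nonneg less_imp_le[OF gibbs_pos])
    show "f x \<le> 1" unfolding f_def sum_gibbs[of t \<phi> x, symmetric]
      by (intro sum_mono2 less_imp_le[OF gibbs_pos]) auto
  qed
  have ff: "f x * (1 - f x) \<le> 1" for x using f01[of x] by (simp add: mult_le_one)
  have "?n ^ 4 * d\<^sup>2 = (?n\<^sup>2 * d)\<^sup>2" by (simp add: power_mult_distrib flip: power_mult)
  then have "(norm v)\<^sup>2 / ?n ^ 4 \<le> d\<^sup>2"
    using power_mono[OF nd, of 2] by (simp add: divide_le_eq mult.commute)
  then have "\<alpha>\<^sup>2 / cut_constant * ((norm v)\<^sup>2 / ?n ^ 4) \<le> \<alpha>\<^sup>2 / cut_constant * d\<^sup>2"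
    using cut_constant_pos by (intro mult_left_mono) auto
  also have "\<dots> \<le> (1 / (1 - t)) * (\<integral>x. f x * (1 - f x) \<partial>\<rho>) * d\<^sup>2"
    by (intro mult_right_mono cut) simp
  also have "\<dots> = (1 / (1 - t)) * (\<integral>x. d\<^sup>2 * (f x * (1 - f x)) \<partial>\<rho>)"
    by (simp only: integral_mult_right_zero) (simp only: mult_ac)
  also have "\<dots> \<le> v \<bullet> (hess t \<phi> *v v)"
    unfolding hess_quadratic_form
  proof (rule mult_left_mono)
    show "(\<integral>x. d\<^sup>2 * (f x * (1 - f x)) \<partial>\<rho>) \<le> (\<integral>x. (\<Sum>k\<in>UNIV. ?p x $ k * (v $ k)\<^sup>2) - (\<Sum>k\<in>UNIV. ?p x $ k * v $ k)\<^sup>2 \<partial>\<rho>)"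
    proof (rule integral_mono)
      show "integrable \<rho> (\<lambda>x. d\<^sup>2 * (f x * (1 - f x)))"
        by (intro integrable_mult_right, rule integrable_const_bound[where B=1])
          (use f01 fb ff in auto)
      have "\<bar>\<Sum>k\<in>UNIV. ?p x $ k * v $ k\<bar> \<le> (\<Sum>k\<in>UNIV. \<bar>v $ k\<bar>)" for x
      proof -
        have "\<bar>\<Sum>k\<in>UNIV. ?p x $ k * v $ k\<bar> \<le> (\<Sum>k\<in>UNIV. \<bar>?p x $ k * v $ k\<bar>)" by (rule sum_abs)
        also have "\<dots> \<le> (\<Sum>k\<in>UNIV. \<bar>v $ k\<bar>)"
          using gibbs_pos gibbs_le_1 by (intro sum_mono) (auto simp: abs_mult abs_of_pos intro!: mult_left_le_one_le less_imp_le[OF gibbs_pos])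
        finally show ?thesis .
      qed
      then have "(\<Sum>k\<in>UNIV. ?p x $ k * v $ k)\<^sup>2 \<le> (\<Sum>k\<in>UNIV. \<bar>v $ k\<bar>)\<^sup>2" for x
        by (metis abs_ge_zero power2_abs power_mono)
      then have "integrable \<rho> (\<lambda>x. (\<Sum>k\<in>UNIV. ?p x $ k * v $ k)\<^sup>2)"
        by (intro integrable_const_bound[where B="(\<Sum>k\<in>UNIV. \<bar>v $ k\<bar>)\<^sup>2"]) auto
      then show "integrable \<rho> (\<lambda>x. (\<Sum>k\<in>UNIV. ?p x $ k * (v $ k)\<^sup>2) - (\<Sum>k\<in>UNIV. ?p x $ k * v $ k)\<^sup>2)"
        by (intro Bochner_Integration.integrable_diff) auto
      show "d\<^sup>2 * (f x * (1 - f x)) \<le> (\<Sum>k\<in>UNIV. ?p x $ k * (v $ k)\<^sup>2) - (\<Sum>k\<in>UNIV. ?p x $ k * v $ k)\<^sup>2" for x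
        unfolding f_def
        by (rule variance_ge_of_gap) (use d gap in \<open>auto simp: sum_gibbs intro!: less_imp_le[OF gibbs_pos]\<close>)
    qed
  qed (use t in simp)
  finally show ?thesis by (simp add: mult_ac)
qed simp

text \<open>The outer factor \<open>1 - t\<close> cancels the factor \<open>1 / (1 - t)\<close> of the first derivative, so the gradient is the vector of
  Gibbs masses minus \<open>\<mu>\<close>, while the second derivative keeps its factor \<open>1 / (1 - t)\<close>.\<close>

lemma has_hessian_smoothed_dual:
  fixes \<mu> :: "real^'N"
  assumes t: "0 \<le> t" "t < 1"
  shows "has_hessian
    (\<lambda>\<phi>. (1 - t) * (\<integral>x. ln (\<Sum>k\<in>UNIV. exp (((1 / (1 - t)) *\<^sub>R \<phi> - (t / (1 - t)) *\<^sub>R a x) $ k)) \<partial>\<rho>)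
      - \<phi> \<bullet> \<mu> - (1 - t)) (hess t \<phi>) \<phi>"
proof -
  define s where "s = 1 / (1 - t)"
  define b where "b x = (t / (1 - t)) *\<^sub>R a x" for x
  have b_borel: "b \<in> borel_measurable \<rho>" unfolding b_def by measurable
  have b_bound: "norm (b x) \<le> (t / (1 - t)) * (CARD('N) * B)" for x
  proof -
    have "norm (a x) \<le> (\<Sum>k\<in>(UNIV::'N set). B)"
      using a_bound by (intro order_trans[OF norm_le_l1_cart] sum_mono) auto
    then show ?thesis using t by (auto simp: b_def intro!: mult_left_mono divide_right_mono)
  qed
  have gibbs: "gibbs t \<phi> x = softmax (s *\<^sub>R \<phi> - b x)" for \<phi> x by (simp add: gibbs_def s_def b_def)
  have norm_gibbs_le_1: "norm (gibbs t \<phi> x) \<le> 1" for \<phi> x by (simp add: gibbs norm_softmax_le_1)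
  have int: "integrable \<rho> (gibbs t \<phi>)" for \<phi>
    by (rule integrable_const_bound[where B=1]) (simp_all add: norm_gibbs_le_1)
  have first: "GDERIV (\<lambda>\<phi>. (1 - t) * (\<integral>x. ln (\<Sum>k\<in>UNIV. exp ((s *\<^sub>R \<phi> - b x) $ k)) \<partial>\<rho>) - \<phi> \<bullet> \<mu> - (1 - t)) \<phi>
      :> (\<integral>x. gibbs t \<phi> x \<partial>\<rho>) - \<mu>" for \<phi>
  proof (rule GDERIV_subst)
    show "GDERIV (\<lambda>\<phi>. (1 - t) * (\<integral>x. ln (\<Sum>k\<in>UNIV. exp ((s *\<^sub>R \<phi> - b x) $ k)) \<partial>\<rho>) - \<phi> \<bullet> \<mu> - (1 - t)) \<phi>
      :> (1 - t) *\<^sub>R (s *\<^sub>R (\<integral>x. softmax (s *\<^sub>R \<phi> - b x) \<partial>\<rho>)) - \<mu> - 0"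
    proof (intro GDERIV_diff GDERIV_const)
      show "GDERIV (\<lambda>\<phi>. (1 - t) * (\<integral>x. ln (\<Sum>k\<in>UNIV. exp ((s *\<^sub>R \<phi> - b x) $ k)) \<partial>\<rho>)) \<phi>
        :> (1 - t) *\<^sub>R (s *\<^sub>R (\<integral>x. softmax (s *\<^sub>R \<phi> - b x) \<partial>\<rho>))"
      proof (rule GDERIV_DERIV_compose[where g="\<lambda>z. (1 - t) * z"])
        show "GDERIV (\<lambda>\<phi>. \<integral>x. ln (\<Sum>k\<in>UNIV. exp ((s *\<^sub>R \<phi> - b x) $ k)) \<partial>\<rho>) \<phi> :> s *\<^sub>R (\<integral>x. softmax (s *\<^sub>R \<phi> - b x) \<partial>\<rho>)"
          by (rule GDERIV_integral_affine[OF finite_measure_axioms b_borel b_bound GDERIV_log_sum_exp softmax_Lipschitz]) simp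
      qed (auto intro!: derivative_eq_intros)
      show "GDERIV (\<lambda>\<phi>. \<phi> \<bullet> \<mu>) \<phi> :> \<mu>"
        unfolding gderiv_def by (rule bounded_linear_imp_has_derivative[OF bounded_linear_inner_left])
    qed
  qed (use t in \<open>simp add: gibbs s_def\<close>)
  have second: "((\<lambda>\<phi>. (\<integral>x. gibbs t \<phi> x \<partial>\<rho>) - \<mu>) has_derivative (\<lambda>h. hess t \<phi> *v h)) (at \<phi>)"
    unfolding has_derivative_componentwise_within[where f="\<lambda>\<phi>. (\<integral>x. gibbs t \<phi> x \<partial>\<rho>) - \<mu>"]
  proof
    fix i :: "real^'N" assume "i \<in> Basis"
    then obtain k where i: "i = axis k 1" by (auto simp: Basis_vec_def)
    have comp: "((\<integral>x. gibbs t \<phi> x \<partial>\<rho>) - \<mu>) \<bullet> i = (\<integral>x. softmax (s *\<^sub>R \<phi> - b x) $ k \<partial>\<rho>) - \<mu> $ k" for \<phi>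
    proof -
      have "(\<integral>x. gibbs t \<phi> x $ k \<partial>\<rho>) = (\<integral>x. gibbs t \<phi> x \<partial>\<rho>) $ k"
        by (rule integral_bounded_linear[OF bounded_linear_vec_nth int])
      then show ?thesis by (simp add: i inner_axis gibbs)
    qed
    have row: "(hess t \<phi> *v h) \<bullet> i = h \<bullet> (hess t \<phi> $ k)" for h
    proof -
      have "(hess t \<phi> *v h) \<bullet> i = (hess t \<phi> *v h) $ k" by (simp add: i inner_axis)
      also have "\<dots> = h \<bullet> (hess t \<phi> $ k)" by (simp add: matrix_vector_mult_def inner_vec_def mult.commute)
      finally show ?thesis .
    qed
    have "GDERIV (\<lambda>\<phi>. \<integral>x. softmax (s *\<^sub>R \<phi> - b x) $ k \<partial>\<rho>) \<phi>
        :> s *\<^sub>R (\<integral>x. (softmax (s *\<^sub>R \<phi> - b x) $ k) *\<^sub>R (axis k 1 - softmax (s *\<^sub>R \<phi> - b x)) \<partial>\<rho>)"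
      by (rule GDERIV_integral_affine[OF finite_measure_axioms b_borel b_bound GDERIV_softmax grad_softmax_Lipschitz]) simp
    also have "s *\<^sub>R (\<integral>x. (softmax (s *\<^sub>R \<phi> - b x) $ k) *\<^sub>R (axis k 1 - softmax (s *\<^sub>R \<phi> - b x)) \<partial>\<rho>) = hess t \<phi> $ k"
      by (simp add: hess_def gibbs s_def)
    finally show "((\<lambda>\<phi>. ((\<integral>x. gibbs t \<phi> x \<partial>\<rho>) - \<mu>) \<bullet> i) has_derivative (\<lambda>h. (hess t \<phi> *v h) \<bullet> i)) (at \<phi>)"
      unfolding comp row gderiv_def by (auto intro!: derivative_eq_intros)
  qed
  show ?thesis
    unfolding has_hessian_def
    by (intro exI[of _ "\<lambda>\<phi>. (\<integral>x. gibbs t \<phi> x \<partial>\<rho>) - \<mu>"] conjI always_eventually allI second)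
      (use first in \<open>simp add: s_def b_def\<close>)
qed

end

section \<open>The uniform lower bound on the smallest eigenvalue\<close>

theorem theorem2p8:
  fixes X :: "(real^'n) set"
    and y :: "'N::finite \<Rightarrow> real^'n"
    and \<rho> :: "(real^'n) measure"
    and r :: "real^'n \<Rightarrow> real"
    and m_lo m_hi \<mu>_lo :: real
    and \<mu> \<psi>0 :: "real^'N"
    and c :: "real^'n \<Rightarrow> real^'n \<Rightarrow> real"
    and grad_c :: "real^'n \<Rightarrow> real^'n \<Rightarrow> real^'n"
  assumes "compact X" and "convex X"
    and "inj y"
    and "prob_space \<rho>"
    and "r \<in> borel_measurable borel"
    and "\<rho> = density lborel (\<lambda>x. ennreal (r x) * indicator X x)"
    and "0 < m_lo"
    and "\<And>x. x \<in> X \<Longrightarrow> m_lo \<le> r x \<and> r x \<le> m_hi"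
    and "(\<Sum>k\<in>UNIV. \<mu> $ k) = 1"
    and "0 < \<mu>_lo" and "\<And>k. \<mu>_lo \<le> \<mu> $ k"
    and "\<And>k x. x \<in> X \<Longrightarrow>
           ((\<lambda>z. c z (y k)) has_derivative (\<lambda>h. grad_c x (y k) \<bullet> h)) (at x within X)"
    and "\<And>k. continuous_on X (\<lambda>x. grad_c x (y k))"
    and "\<And>x0. x0 \<in> X \<Longrightarrow> inj_on (grad_c x0) (range y)"
    and "\<And>i. \<mu> $ i = measure \<rho> (Lag X c y \<psi>0 i)"
  shows "\<exists>C>0. \<exists>\<delta>>0. \<forall>t\<in>{0..<1}. \<forall>\<psi>::real^'N.
           (norm (\<psi> - \<psi>0))\<^sup>2 \<le> \<delta> \<and> (\<Sum>i\<in>UNIV. \<psi> $ i) = 0 \<longrightarrow>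
           (\<exists>H. has_hessian (\<lambda>\<phi>. Phi X \<rho> c y \<mu> \<phi> t) H \<psi> \<and> lambda_min_perp H \<ge> ereal C)"
proof -
  have X_borel: "X \<in> sets borel" using \<open>compact X\<close> by (simp add: compact_imp_closed borel_closed)
  interpret prob_space \<rho> by fact
  interpret density_on_convex \<rho> X r m_lo m_hi
    by unfold_locales (use assms X_borel in auto)

  have c_cont: "continuous_on X (\<lambda>x. c x (y k))" for k
    by (rule has_derivative_continuous_on) (rule assms(12))
  define a :: "real^'n \<Rightarrow> real^'N" where "a x = indicator X x *\<^sub>R (\<chi> k. c x (y k))" for x
  have a_X: "a x $ k = c x (y k)" if "x \<in> X" for x k using that by (simp add: a_def)

  have "bounded (\<Union>k. (\<lambda>x. c x (y k)) ` X)"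
    by (intro bounded_UN ballI compact_imp_bounded compact_continuous_image c_cont \<open>compact X\<close>) simp
  then obtain B where B: "\<And>x k. x \<in> X \<Longrightarrow> \<bar>c x (y k)\<bar> \<le> B" and B0: "0 < B"
    unfolding bounded_pos by fastforce
  have "bounded (\<Union>k. (\<lambda>x. grad_c x (y k)) ` X)"
    by (intro bounded_UN ballI compact_imp_bounded compact_continuous_image assms(13) \<open>compact X\<close>) simp
  then obtain L where L: "\<And>x k. x \<in> X \<Longrightarrow> norm (grad_c x (y k)) \<le> L" and L0: "0 < L"
    unfolding bounded_pos by fastforce
  have lip: "\<bar>c z (y k) - c x (y k)\<bar> \<le> L * norm (z - x)" if xz: "x \<in> X" "z \<in> X" for x z k
  proof -
    have "norm (c z (y k) - c x (y k)) \<le> L * norm (z - x)"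
    proof (rule differentiable_bound[OF \<open>convex X\<close> _ _ xz(2,1)])
      fix w assume w: "w \<in> X"
      show "((\<lambda>z. c z (y k)) has_derivative (\<lambda>h. grad_c w (y k) \<bullet> h)) (at w within X)"
        by (rule assms(12)[OF w])
      show "onorm (\<lambda>h. grad_c w (y k) \<bullet> h) \<le> L"
      proof (rule onorm_le)
        fix h
        show "norm (grad_c w (y k) \<bullet> h) \<le> L * norm h"
          using Cauchy_Schwarz_ineq2[of "grad_c w (y k)" h] mult_right_mono[OF L[OF w, of k], of "norm h"]
          by simp
      qed
    qed
    then show ?thesis by simp
  qed
  obtain D where D: "\<And>x z. x \<in> X \<Longrightarrow> z \<in> X \<Longrightarrow> norm (z - x) \<le> D" and D0: "0 \<le> D"
    using bounded_two_points compact_imp_bounded[OF \<open>compact X\<close>]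
    by (metis diameter_bounded_bound diameter_ge_0 dist_norm)
  interpret smoothed_transport \<rho> X r m_lo m_hi a B L D
  proof
    show "a \<in> borel_measurable borel"
      unfolding a_def by (intro borel_measurable_continuous_on_indicator X_borel continuous_intros c_cont)
    show "\<bar>a x $ k\<bar> \<le> B" for x k using B[of x k] B0 by (auto simp: a_def indicator_def)
    show "\<bar>a z $ k - a x $ k\<bar> \<le> L * norm (z - x)" if "x \<in> X" "z \<in> X" for x z k
      using lip[OF that] that by (simp add: a_X)
  qed (use L0 D D0 in auto)

  have Phi: "Phi X \<rho> c y \<mu> \<phi> t = (1 - t) * (\<integral>x. ln (\<Sum>k\<in>UNIV. exp (((1 / (1 - t)) *\<^sub>R \<phi> - (t / (1 - t)) *\<^sub>R a x) $ k)) \<partial>\<rho>)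
      - \<phi> \<bullet> \<mu> - (1 - t)" for \<phi> t
  proof -
    let ?l = "\<lambda>x. ln (\<Sum>k\<in>UNIV. exp (((1 / (1 - t)) *\<^sub>R \<phi> - (t / (1 - t)) *\<^sub>R a x) $ k))"
    have on_X: "indicator X x *\<^sub>R ((1 - t) * ln (\<Sum>k\<in>UNIV. exp ((\<phi> $ k - t * c x (y k)) / (1 - t))))
        = indicator X x * ((1 - t) * ?l x)" for x
      by (cases "x \<in> X") (simp_all add: a_X diff_divide_distrib)
    have "(LINT x:X|\<rho>. (1 - t) * ln (\<Sum>k\<in>UNIV. exp ((\<phi> $ k - t * c x (y k)) / (1 - t))))
        = (\<integral>x. indicator X x * ((1 - t) * ?l x) \<partial>\<rho>)"
      unfolding set_lebesgue_integral_def on_X ..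
    also have "\<dots> = (\<integral>x. (1 - t) * ?l x \<partial>\<rho>)"
    proof (rule integral_cong_AE)
      have l: "?l \<in> borel_measurable borel"
        by (simp add: a_nth_borel)
      then show "(\<lambda>x. (1 - t) * ?l x) \<in> borel_measurable \<rho>" "(\<lambda>x. indicator X x * ((1 - t) * ?l x)) \<in> borel_measurable \<rho>"
        using X_borel by measurable
      show "AE x in \<rho>. indicator X x * ((1 - t) * ?l x) = (1 - t) * ?l x"
        using AE_in_X by eventually_elim simp
    qed
    finally show ?thesis by (simp add: Phi_def inner_vec_def)
  qed

  have Lag: "Lag X c y \<psi>0 k = {x\<in>X. \<forall>l. l \<noteq> k \<longrightarrow> a x $ k - \<psi>0 $ k \<le> a x $ l - \<psi>0 $ l}" for k
    by (auto simp: Lag_def a_X)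
  have strict: "\<mu> $ k \<le> measure \<rho> {x\<in>X. \<forall>l. l \<noteq> k \<longrightarrow> a x $ k - \<psi>0 $ k < a x $ l - \<psi>0 $ l}" for k
    by (rule strict_cell_mass) (use assms(9,15) Lag in auto)
  have pos: "0 < \<mu> $ k" for k using assms(10) assms(11)[of k] by linarith
  obtain \<alpha> \<eta> where \<alpha>: "0 < \<alpha>" and \<eta>: "0 < \<eta>" and mass:
    "\<And>t \<phi> k. 0 \<le> t \<Longrightarrow> t < 1 \<Longrightarrow> (\<And>l. \<bar>\<phi> $ l - \<psi>0 $ l\<bar> \<le> \<eta>) \<Longrightarrow> \<alpha> \<le> (\<integral>x. gibbs t \<phi> x $ k \<partial>\<rho>)"
    by (rule gibbs_mass_lower_bound[OF strict pos]) blast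
  let ?C = "\<alpha>\<^sup>2 / (cut_constant * CARD('N) ^ 4)"
  show ?thesis
  proof (intro exI conjI ballI allI impI)
    show "0 < ?C" using \<alpha> cut_constant_pos by simp
    \<comment> \<open>the hypothesis on \<open>\<psi>\<close> bounds the square of the norm, so \<open>\<delta>\<close> is \<open>\<eta>\<^sup>2\<close>\<close>
    show "0 < \<eta>\<^sup>2" using \<eta> by simp
    fix t :: real and \<psi> :: "real^'N"
    assume t: "t \<in> {0..<1}" and \<psi>: "(norm (\<psi> - \<psi>0))\<^sup>2 \<le> \<eta>\<^sup>2 \<and> (\<Sum>i\<in>UNIV. \<psi> $ i) = 0"
    have t': "0 \<le> t" "t < 1" using t by auto
    have "norm (\<psi> - \<psi>0) \<le> \<eta>" using \<psi> \<eta> by (simp add: power2_le_iff_abs_le)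
    then have near: "\<bar>\<psi> $ l - \<psi>0 $ l\<bar> \<le> \<eta>" for l
      using component_le_norm_cart[of "\<psi> - \<psi>0" l] by simp
    show "has_hessian (\<lambda>\<phi>. Phi X \<rho> c y \<mu> \<phi> t) (hess t \<psi>) \<psi>"
      unfolding Phi by (rule has_hessian_smoothed_dual[OF t'])
    show "ereal ?C \<le> lambda_min_perp (hess t \<psi>)"
      unfolding lambda_min_perp_def
    proof (rule INF_greatest)
      fix v :: "real^'N" assume v: "v \<in> {v. v \<noteq> 0 \<and> (\<Sum>k\<in>UNIV. v $ k) = 0}"
      then have "?C * (norm v)\<^sup>2 \<le> v \<bullet> (hess t \<psi> *v v)"
        by (intro hess_coercive t' \<alpha> mass near) auto
      then show "ereal ?C \<le> ereal (v \<bullet> (hess t \<psi> *v v) / (norm v)\<^sup>2)"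
        using v by (simp add: le_divide_eq)
    qed
  qed
qed

end
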